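(* Let $\alpha\in\mathbb R\setminus\mathbb N$, and write each $f\in\mathcal F$ as the column vector $(f_1(z_1),f_2(z_1),f_3(z_1),f_4(z_1))^t$, where $f=f_1(z_1)+f_2(z_1)z_2+f_3(z_1)z_3+f_4(z_1)z_4$. Let $\mathbb E:=z_1\partial_{z_1}$ denote the Euler operator acting on the $f_i(z_1)$. Then the representation $\rho_0$ on $\mathcal F$ is given, for all $k_1,k_2,k_3,a_1,a_3\in\mathbb R$, by \begin{align*} \rho_0(K_1(k_1))f&=\begin{pmatrix}1&0&0&0\\0&1&0&0\\0&0&\cos(k_1)&2\sin(k_1)\\0&0&-2^{-1}\sin(k_1)&\cos(k_1)\end{pmatrix}f,\\ \rho_0(K_2(k_2))f&=\begin{pmatrix}e^{\imath k_2(\alpha-2\mathbb E)}&0&0&0\\0&e^{\imath k_2(\alpha-2\mathbb E)}&0&0\\0&0&e^{\imath k_2(\alpha-1-2\mathbb E)}&0\\0&0&0&e^{\imath k_2(\alpha-1-2\mathbb E)}\end{pmatrix}f,\\ \rho_0(K_3(k_3))f&=\begin{pmatrix}e^{\imath k_3}&0&0&0\\0&e^{-\imath k_3}&0&0\\0&0&1&0\\0&0&0&1\end{pmatrix}f,\\ \rho_0(A_1(a_1))f&=\begin{pmatrix}1&0&0&0\\0&1&0&0\\0&0&e^{-a_1}&0\\0&0&0&e^{a_1}\end{pmatrix}f,\\ \rho_0(A_3(a_3))f&=\begin{pmatrix}\cosh(a_3)&\sinh(a_3)&0&0\\\sinh(a_3)&\cosh(a_3)&0&0\\0&0&1&0\\0&0&0&1\end{pmatrix}f.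 \end{align*}
   Context: Conventions: $\mathbb N=\{0,1,2,\dots\}$, $\imath$ is the imaginary unit, $(a)_k=a(a+1)\cdots(a+k-1)$. Polynomial Fock space: $F:=\mathcal P(\mathbb C^{2|2})/\mathcal I$, where $\mathcal P(\mathbb C^{2|2})$ denotes complex superpolynomials in even $z_1,z_2$ and odd $z_3,z_4$, and $\mathcal I$ is the ideal generated by $2z_1z_2+z_3z_4,\ z_2^2,\ z_2z_3,\ z_2z_4$. The classes of $z_1^k,z_1^kz_2,z_1^kz_3,z_1^kz_4$ ($k\in\mathbb N$) form a basis of $F$. Fock space: $\mathcal F$ is the completion of $F$ for the inner product $(\cdot,\cdot)_S$ for which this basis is orthogonal with $(z_1^k,z_1^k)_S=(z_1^kz_2,z_1^kz_2)_S=k!|(-\alpha)_k|$ and $(z_1^kz_3,z_1^kz_3)_S=(z_1^kz_4,z_1^kz_4)_S=2k!|(-\alpha)_{k+1}|$. Its elements are series $f=f_{1,0}+\sum_{k\ge1}z_1^{k-1}(f_{1,k}z_1+f_{2,k}z_2+f_{3,k}z_3+f_{4,k}z_4)$ of finite norm, $f_{i,k}\in\mathbb C$. Put $f_1(z_1):=\sum_{k\ge0}f_{1,k}z_1^k$ and $f_i(z_1):=\sum_{k\ge0}f_{i,k+1}z_1^k$ for $i\in\{2,3,4\}$. Groups: $V_1,V_2,V_3$ are copies of $\mathbb R^2$; $G_0=SL(V_1)\times SL(V_2)\times SL(V_3)$; $\mathfrak{sl}(V_i)$ has basis $E_i=\begin{pmatrix}0&1\\0&0\end{pmatrix}$, $F_i=\begin{pmatrix}0&0\\1&0\end{pmatrix}$,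 $H_i=\begin{pmatrix}1&0\\0&-1\end{pmatrix}$; $K_i(k)=\begin{pmatrix}\cos k&-\sin k\\ \sin k&\cos k\end{pmatrix}=\exp(k(F_i-E_i))$, $A_i(a)=\begin{pmatrix}e^a&0\\0&e^{-a}\end{pmatrix}=\exp(aH_i)$. Action: with $\partial_i=\partial_{z_i}$, let $\mathcal B(z_1)=(-\alpha+z_1\partial_1+z_3\partial_3+z_4\partial_4)\partial_1-2\alpha z_2\partial_3\partial_4$ and $\mathcal B(z_2)=(-1+z_2\partial_2+z_3\partial_3+z_4\partial_4)\partial_2-2z_1\partial_3\partial_4$. The even part $\mathfrak g_{\bar0}=\mathfrak{sl}(V_1)\oplus\mathfrak{sl}(V_2)\oplus\mathfrak{sl}(V_3)$ acts on $F$ by $d\rho(F_1)=2z_3\partial_4$, $d\rho(E_1)=\tfrac12z_4\partial_3$, $d\rho(H_1)=z_4\partial_4-z_3\partial_3$, $d\rho(H_2)=z_1-\mathcal B(z_1)$, $d\rho(H_3)=z_2-\mathcal B(z_2)$, $d\rho(F_2)=-\tfrac{\imath}{2}(z_1+\mathcal B(z_1))-\tfrac{\imath}{2}(-\alpha+2z_1\partial_1+z_3\partial_3+z_4\partial_4)$, $d\rho(E_2)=-\tfrac{\imath}{2}(z_1+\mathcal B(z_1))+\tfrac{\imath}{2}(-\alpha+2z_1\partial_1+z_3\partial_3+z_4\partial_4)$, $d\rho(F_3)=-\tfrac{\imath}{2}(z_2+\mathcal B(z_2))-\tfrac{\imath}{2}(-1+2z_2\partial_2+z_3\partial_3+z_4\partial_4)$,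 $d\rho(E_3)=-\tfrac{\imath}{2}(z_2+\mathcal B(z_2))+\tfrac{\imath}{2}(-1+2z_2\partial_2+z_3\partial_3+z_4\partial_4)$. The action $\rho_0$ is defined by $\rho_0(\exp(X)):=\exp(d\rho(X))$ for $X\in\mathfrak g_{\bar0}$.
   Formalization: For non-integer α, ρ_0(exp X) depends on X and not only on exp X (K_2(2π)=1, but the formula gives e^{2πiα} on f_1), so ρ_0(K_i(k)) and ρ_0(A_i(a)) are read as exp(dρ(X)) with X=k(F_i−E_i) and X=aH_i respectively. *)

theory Defs
  imports
    "HOL-Analysis.Analysis"
    "HOL-Computational_Algebra.Polynomial_FPS"
    "HOL-Library.Function_Algebras"
begin

unbundle no fps_syntax

section \<open>Superpolynomials in even z1, z2 and odd z3, z4\<close>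

text \<open>\<open>SP a b c d\<close> stands for \<open>a + b z3 + c z4 + d z3 z4\<close>.
  In \<open>complex poly poly\<close> the outer variable is z2 and the inner one is z1.\<close>

datatype superpoly =
  SP (sp0: "complex poly poly") (sp3: "complex poly poly")
     (sp4: "complex poly poly") (sp34: "complex poly poly")

instantiation superpoly :: ring_1
begin

definition zero_superpoly :: superpoly where "0 = SP 0 0 0 0"
definition one_superpoly :: superpoly where "1 = SP 1 0 0 0"
definition plus_superpoly :: "superpoly \<Rightarrow> superpoly \<Rightarrow> superpoly" where
  "p + q = SP (sp0 p + sp0 q) (sp3 p + sp3 q) (sp4 p + sp4 q) (sp34 p + sp34 q)"
definition minus_superpoly :: "superpoly \<Rightarrow> superpoly \<Rightarrow> superpoly" where
  "p - q = SP (sp0 p - sp0 q) (sp3 p - sp3 q) (sp4 p - sp4 q) (sp34 p - sp34 q)"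
definition uminus_superpoly :: "superpoly \<Rightarrow> superpoly" where
  "- p = SP (- sp0 p) (- sp3 p) (- sp4 p) (- sp34 p)"
definition times_superpoly :: "superpoly \<Rightarrow> superpoly \<Rightarrow> superpoly" where
  "p * q = SP (sp0 p * sp0 q)
              (sp0 p * sp3 q + sp3 p * sp0 q)
              (sp0 p * sp4 q + sp4 p * sp0 q)
              (sp0 p * sp34 q + sp34 p * sp0 q + sp3 p * sp4 q - sp4 p * sp3 q)"

instance
  by standard
    (simp_all add: zero_superpoly_def one_superpoly_def plus_superpoly_def minus_superpoly_def
      uminus_superpoly_def times_superpoly_def algebra_simps)

end

lemma superpoly_sel_simps [simp]:
  "sp0 0 = 0" "sp3 0 = 0" "sp4 0 = 0" "sp34 0 = 0"
  "sp0 1 = 1" "sp3 1 = 0" "sp4 1 = 0" "sp34 1 = 0"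
  "sp0 (p + q) = sp0 p + sp0 q" "sp3 (p + q) = sp3 p + sp3 q"
  "sp4 (p + q) = sp4 p + sp4 q" "sp34 (p + q) = sp34 p + sp34 q"
  "sp0 (p - q) = sp0 p - sp0 q" "sp3 (p - q) = sp3 p - sp3 q"
  "sp4 (p - q) = sp4 p - sp4 q" "sp34 (p - q) = sp34 p - sp34 q"
  "sp0 (- p) = - sp0 p" "sp3 (- p) = - sp3 p" "sp4 (- p) = - sp4 p" "sp34 (- p) = - sp34 p"
  "sp0 (p * q) = sp0 p * sp0 q"
  "sp3 (p * q) = sp0 p * sp3 q + sp3 p * sp0 q"
  "sp4 (p * q) = sp0 p * sp4 q + sp4 p * sp0 q"
  "sp34 (p * q) = sp0 p * sp34 q + sp34 p * sp0 q + sp3 p * sp4 q - sp4 p * sp3 q"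
  by (simp_all add: zero_superpoly_def one_superpoly_def plus_superpoly_def minus_superpoly_def
      uminus_superpoly_def times_superpoly_def)

definition sconst :: "complex \<Rightarrow> superpoly" where "sconst c = SP [:[:c:]:] 0 0 0"

definition z1 :: superpoly where "z1 = SP [:[:0, 1:]:] 0 0 0"
definition z2 :: superpoly where "z2 = SP [:0, 1:] 0 0 0"
definition z3 :: superpoly where "z3 = SP 0 1 0 0"
definition z4 :: superpoly where "z4 = SP 0 0 1 0"

text \<open>The odd derivatives are left derivatives: \<open>d3 (z3 z4) = z4\<close> and \<open>d4 (z3 z4) = - z3\<close>.\<close>

definition d1 :: "superpoly \<Rightarrow> superpoly" where
  "d1 p = SP (map_poly pderiv (sp0 p)) (map_poly pderiv (sp3 p))
             (map_poly pderiv (sp4 p)) (map_poly pderiv (sp34 p))"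
definition d2 :: "superpoly \<Rightarrow> superpoly" where
  "d2 p = SP (pderiv (sp0 p)) (pderiv (sp3 p)) (pderiv (sp4 p)) (pderiv (sp34 p))"
definition d3 :: "superpoly \<Rightarrow> superpoly" where "d3 p = SP (sp3 p) 0 (sp34 p) 0"
definition d4 :: "superpoly \<Rightarrow> superpoly" where "d4 p = SP (sp4 p) (- sp34 p) 0 0"


section \<open>The Lie algebra and its action on superpolynomials\<close>

type_synonym mat2 = "real^2^2"

text \<open>A triple of trace-free matrices represents an element of
  \<open>sl(V1) + sl(V2) + sl(V3)\<close>; a triple of determinant one represents an element of the group.\<close>

type_synonym mat2_triple = "mat2 \<times> mat2 \<times> mat2"

definition slE :: mat2 where "slE = vector [vector [0, 1], vector [0, 0]]"
definition slF :: mat2 where "slF = vector [vector [0, 0], vector [1, 0]]"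
definition slH :: mat2 where "slH = vector [vector [1, 0], vector [0, -1]]"

text \<open>\<open>Bz1 \<alpha>\<close> and \<open>Bz2\<close> are the Bessel operators \<open>B(z1)\<close> and \<open>B(z2)\<close>.\<close>

definition Bz1 :: "real \<Rightarrow> superpoly \<Rightarrow> superpoly" where
  "Bz1 \<alpha> p = (let q = d1 p in
     sconst (- of_real \<alpha>) * q + z1 * d1 q + z3 * d3 q + z4 * d4 q)
     - sconst (2 * of_real \<alpha>) * (z2 * d3 (d4 p))"

definition Bz2 :: "superpoly \<Rightarrow> superpoly" where
  "Bz2 p = (let q = d2 p in - q + z2 * d2 q + z3 * d3 q + z4 * d4 q)
     - 2 * (z1 * d3 (d4 p))"

definition L1 :: "real \<Rightarrow> superpoly \<Rightarrow> superpoly" where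
  "L1 \<alpha> p = sconst (- of_real \<alpha>) * p + 2 * (z1 * d1 p) + z3 * d3 p + z4 * d4 p"

definition L2 :: "superpoly \<Rightarrow> superpoly" where
  "L2 p = - p + 2 * (z2 * d2 p) + z3 * d3 p + z4 * d4 p"

definition drho_E1 :: "superpoly \<Rightarrow> superpoly" where
  "drho_E1 p = sconst (1/2) * (z4 * d3 p)"
definition drho_F1 :: "superpoly \<Rightarrow> superpoly" where
  "drho_F1 p = 2 * (z3 * d4 p)"
definition drho_H1 :: "superpoly \<Rightarrow> superpoly" where
  "drho_H1 p = z4 * d4 p - z3 * d3 p"

definition drho_E2 :: "real \<Rightarrow> superpoly \<Rightarrow> superpoly" where
  "drho_E2 \<alpha> p = sconst (- \<i>/2) * (z1 * p + Bz1 \<alpha> p) + sconst (\<i>/2) * L1 \<alpha> p"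
definition drho_F2 :: "real \<Rightarrow> superpoly \<Rightarrow> superpoly" where
  "drho_F2 \<alpha> p = sconst (- \<i>/2) * (z1 * p + Bz1 \<alpha> p) - sconst (\<i>/2) * L1 \<alpha> p"
definition drho_H2 :: "real \<Rightarrow> superpoly \<Rightarrow> superpoly" where
  "drho_H2 \<alpha> p = z1 * p - Bz1 \<alpha> p"

definition drho_E3 :: "superpoly \<Rightarrow> superpoly" where
  "drho_E3 p = sconst (- \<i>/2) * (z2 * p + Bz2 p) + sconst (\<i>/2) * L2 p"
definition drho_F3 :: "superpoly \<Rightarrow> superpoly" where
  "drho_F3 p = sconst (- \<i>/2) * (z2 * p + Bz2 p) - sconst (\<i>/2) * L2 p"
definition drho_H3 :: "superpoly \<Rightarrow> superpoly" where
  "drho_H3 p = z2 * p - Bz2 p"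

text \<open>Linear extension, using that a trace-free 2x2 matrix \<open>X\<close> equals
  \<open>X$1$2 E + X$2$1 F + X$1$1 H\<close>.\<close>

definition sl_comb ::
  "mat2 \<Rightarrow> (superpoly \<Rightarrow> superpoly) \<Rightarrow> (superpoly \<Rightarrow> superpoly) \<Rightarrow> (superpoly \<Rightarrow> superpoly)
     \<Rightarrow> superpoly \<Rightarrow> superpoly" where
  "sl_comb X e f h p = sconst (of_real (X $ 1 $ 2)) * e p
     + sconst (of_real (X $ 2 $ 1)) * f p
     + sconst (of_real (X $ 1 $ 1)) * h p"

definition drho_poly :: "real \<Rightarrow> mat2_triple \<Rightarrow> superpoly \<Rightarrow> superpoly" where
  "drho_poly \<alpha> X p = (case X of (X1, X2, X3) \<Rightarrow>
     sl_comb X1 drho_E1 drho_F1 drho_H1 p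
     + sl_comb X2 (drho_E2 \<alpha>) (drho_F2 \<alpha>) (drho_H2 \<alpha>) p
     + sl_comb X3 drho_E3 drho_F3 drho_H3 p)"


section \<open>The polynomial Fock space\<close>

inductive_set fock_ideal :: "superpoly set" where
  gen1: "2 * z1 * z2 + z3 * z4 \<in> fock_ideal"
| gen2: "z2 * z2 \<in> fock_ideal"
| gen3: "z2 * z3 \<in> fock_ideal"
| gen4: "z2 * z4 \<in> fock_ideal"
| zero: "0 \<in> fock_ideal"
| add: "p \<in> fock_ideal \<Longrightarrow> q \<in> fock_ideal \<Longrightarrow> p + q \<in> fock_ideal"
| lmult: "p \<in> fock_ideal \<Longrightarrow> r * p \<in> fock_ideal"
| rmult: "p \<in> fock_ideal \<Longrightarrow> p * r \<in> fock_ideal"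

lemma fock_ideal_uminus: "p \<in> fock_ideal \<Longrightarrow> - p \<in> fock_ideal"
  using fock_ideal.lmult[of p "-1"] by simp

lemma fock_ideal_diff: "p \<in> fock_ideal \<Longrightarrow> q \<in> fock_ideal \<Longrightarrow> p - q \<in> fock_ideal"
  using fock_ideal.add[of p "- q"] fock_ideal_uminus[of q] by simp

lemma coeff_1_mult:
  "coeff (p * q) (Suc 0) = coeff p 0 * coeff q (Suc 0) + coeff p (Suc 0) * coeff q 0"
  for p q :: "'a::comm_semiring_0 poly"
  by (simp add: coeff_mult)

lemma two_superpoly: "(2::superpoly) = SP 2 0 0 0"
  unfolding one_add_one[symmetric] by (simp add: one_superpoly_def plus_superpoly_def)

lemma coeff_two_poly: "coeff (2 :: complex poly poly) 0 = 2"
    "coeff (2 :: complex poly poly) (Suc 0) = 0"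
  by (simp_all add: numeral_poly)

lemma fock_ideal_iff:
  "p \<in> fock_ideal \<longleftrightarrow>
     coeff (sp0 p) 0 = 0 \<and> coeff (sp0 p) (Suc 0) = [:0, 2:] * coeff (sp34 p) 0 \<and>
     coeff (sp3 p) 0 = 0 \<and> coeff (sp4 p) 0 = 0" (is "_ \<longleftrightarrow> ?N p")
proof
  assume "p \<in> fock_ideal"
  then show "?N p"
  proof (induction p rule: fock_ideal.induct)
    case gen1
    have "[:0, 2::complex:] = 2 * [:0, 1:]" by (simp add: numeral_poly)
    then show ?case
      by (simp add: two_superpoly z1_def z2_def z3_def z4_def coeff_1_mult coeff_mult_0 coeff_two_poly)
  qed (auto simp: z1_def z2_def z3_def z4_def coeff_1_mult coeff_mult_0 algebra_simps)
next
  assume N: "?N p"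
  obtain a b c d where p: "p = SP a b c d" by (cases p)
  obtain a0 a' where a: "a = pCons a0 a'" by (cases a)
  obtain a1 a'' where a': "a' = pCons a1 a''" by (cases a')
  obtain b0 b' where b: "b = pCons b0 b'" by (cases b)
  obtain c0 c' where c: "c = pCons c0 c'" by (cases c)
  obtain d0 d' where d: "d = pCons d0 d'" by (cases d)
  have N0: "a0 = 0" "a1 = [:0, 2:] * d0" "b0 = 0" "c0 = 0"
    using N by (simp_all add: p a a' b c d)
  have "p = SP a'' 0 0 0 * (z2 * z2) + SP b' 0 0 0 * (z2 * z3) + SP c' 0 0 0 * (z2 * z4)
      + SP [:d0:] 0 0 0 * (2 * z1 * z2 + z3 * z4) + SP d' 0 0 0 * ((z2 * z3) * z4)"
    by (intro superpoly.expand)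
      (simp add: p a a' b c d N0 two_superpoly z1_def z2_def z3_def z4_def numeral_poly)
  then show "p \<in> fock_ideal"
    by (metis fock_ideal.intros)
qed

definition fock_rel :: "superpoly \<Rightarrow> superpoly \<Rightarrow> bool" where
  "fock_rel p q \<longleftrightarrow> p - q \<in> fock_ideal"

lemma equivp_fock_rel: "equivp fock_rel"
proof (rule equivpI)
  show "reflp fock_rel" by (simp add: reflp_def fock_rel_def fock_ideal.zero)
  show "symp fock_rel"
    unfolding symp_def fock_rel_def by (metis fock_ideal_uminus minus_diff_eq)
  show "transp fock_rel"
    unfolding transp_def fock_rel_def by (metis fock_ideal.add diff_add_cancel add_diff_eq)
qed

quotient_type fockpoly = superpoly / fock_rel
  by (rule equivp_fock_rel)

lift_definition fock_class :: "superpoly \<Rightarrow> fockpoly" is "\<lambda>p. p" .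

lemma fock_class_eq_iff: "fock_class p = fock_class q \<longleftrightarrow> p - q \<in> fock_ideal"
  by transfer (simp add: fock_rel_def)

lemma map_poly_pderiv_diff:
  "map_poly pderiv (p - q) = map_poly pderiv p - map_poly pderiv q" for p q :: "complex poly poly"
  by (rule poly_eqI) (simp add: coeff_map_poly pderiv_diff)

lemma superpoly_derivs_diff:
  "d1 (p - q) = d1 p - d1 q" "d2 (p - q) = d2 p - d2 q"
  "d3 (p - q) = d3 p - d3 q" "d4 (p - q) = d4 p - d4 q"
  by (simp_all add: d1_def d2_def d3_def d4_def minus_superpoly_def map_poly_pderiv_diff pderiv_diff)

lemma Bz_L_diff:
  "Bz1 \<alpha> (p - q) = Bz1 \<alpha> p - Bz1 \<alpha> q" "Bz2 (p - q) = Bz2 p - Bz2 q"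
  "L1 \<alpha> (p - q) = L1 \<alpha> p - L1 \<alpha> q" "L2 (p - q) = L2 p - L2 q"
  by (simp_all add: Bz1_def Bz2_def L1_def L2_def Let_def superpoly_derivs_diff right_diff_distrib)

lemma drho_basis_diff:
  "drho_E1 (p - q) = drho_E1 p - drho_E1 q"
  "drho_F1 (p - q) = drho_F1 p - drho_F1 q"
  "drho_H1 (p - q) = drho_H1 p - drho_H1 q"
  "drho_E2 \<alpha> (p - q) = drho_E2 \<alpha> p - drho_E2 \<alpha> q"
  "drho_F2 \<alpha> (p - q) = drho_F2 \<alpha> p - drho_F2 \<alpha> q"
  "drho_H2 \<alpha> (p - q) = drho_H2 \<alpha> p - drho_H2 \<alpha> q"
  "drho_E3 (p - q) = drho_E3 p - drho_E3 q"
  "drho_F3 (p - q) = drho_F3 p - drho_F3 q"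
  "drho_H3 (p - q) = drho_H3 p - drho_H3 q"
  by (simp_all add: drho_E1_def drho_F1_def drho_H1_def drho_E2_def drho_F2_def drho_H2_def
      drho_E3_def drho_F3_def drho_H3_def superpoly_derivs_diff Bz_L_diff
      right_diff_distrib distrib_left)

lemma sl_comb_diff:
  assumes "e (p - q) = e p - e q" "f (p - q) = f p - f q" "h (p - q) = h p - h q"
  shows "sl_comb X e f h (p - q) = sl_comb X e f h p - sl_comb X e f h q"
  by (simp add: sl_comb_def assms right_diff_distrib)

lemma drho_poly_diff: "drho_poly \<alpha> X (p - q) = drho_poly \<alpha> X p - drho_poly \<alpha> X q"
  by (cases X) (simp add: drho_poly_def sl_comb_diff drho_basis_diff)

lemma coeff_two_mult: "coeff (2 * p) n = 2 * coeff p n" for p :: "'a::comm_semiring_1 poly"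
  by (simp add: mult_2)

lemma Bz_L_ideal:
  assumes "p \<in> fock_ideal"
  shows "z4 * d3 p \<in> fock_ideal" "z3 * d4 p \<in> fock_ideal"
    "z4 * d4 p - z3 * d3 p \<in> fock_ideal"
    "Bz1 \<alpha> p \<in> fock_ideal" "Bz2 p \<in> fock_ideal"
    "L1 \<alpha> p \<in> fock_ideal" "L2 p \<in> fock_ideal"
proof -
  obtain a b c d where p: "p = SP a b c d" by (cases p)
  have N: "coeff a 0 = 0" "coeff a (Suc 0) = [:0, 2:] * coeff d 0"
      "coeff b 0 = 0" "coeff c 0 = 0"
    using assms by (simp_all add: fock_ideal_iff p)
  have s2: "2 * x = smult 2 x" for x :: "complex poly"
    by (simp add: numeral_poly)
  note defs = p fock_ideal_iff z1_def z2_def z3_def z4_def d1_def d2_def d3_def d4_def N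
    coeff_map_poly coeff_pderiv coeff_two_mult coeff_1_mult coeff_mult_0
    two_superpoly sconst_def coeff_two_poly pderiv_pCons pderiv_smult pderiv_add s2
    smult_add_right smult_diff_right smult_add_left
  show "z4 * d3 p \<in> fock_ideal" by (simp add: defs)
  show "z3 * d4 p \<in> fock_ideal" by (simp add: defs)
  show "z4 * d4 p - z3 * d3 p \<in> fock_ideal" by (simp add: defs)
  show "L1 \<alpha> p \<in> fock_ideal"
    by (simp add: defs L1_def)
  show "L2 p \<in> fock_ideal"
    by (simp add: defs L2_def)
  show "Bz1 \<alpha> p \<in> fock_ideal"
    by (simp add: defs Bz1_def Let_def, rule poly_eqI)
      (simp add: coeff_pCons algebra_simps split: nat.split)
  show "Bz2 p \<in> fock_ideal"
    by (simp add: defs Bz2_def Let_def)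
qed

lemma drho_basis_ideal:
  assumes "p \<in> fock_ideal"
  shows "drho_E1 p \<in> fock_ideal" "drho_F1 p \<in> fock_ideal" "drho_H1 p \<in> fock_ideal"
    "drho_E2 \<alpha> p \<in> fock_ideal" "drho_F2 \<alpha> p \<in> fock_ideal" "drho_H2 \<alpha> p \<in> fock_ideal"
    "drho_E3 p \<in> fock_ideal" "drho_F3 p \<in> fock_ideal" "drho_H3 p \<in> fock_ideal"
  unfolding drho_E1_def drho_F1_def drho_H1_def drho_E2_def drho_F2_def drho_H2_def
    drho_E3_def drho_F3_def drho_H3_def
  by (fact fock_ideal.lmult[OF Bz_L_ideal(1)[OF assms]]
           fock_ideal.lmult[OF Bz_L_ideal(2)[OF assms]]
           Bz_L_ideal(3)[OF assms]
    | intro fock_ideal.add fock_ideal_diff fock_ideal.lmult Bz_L_ideal(4-7) assms)+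

lemma sl_comb_ideal:
  assumes "e p \<in> fock_ideal" "f p \<in> fock_ideal" "h p \<in> fock_ideal"
  shows "sl_comb X e f h p \<in> fock_ideal"
  unfolding sl_comb_def by (intro fock_ideal.add fock_ideal.lmult assms)

lemma drho_poly_ideal: "p \<in> fock_ideal \<Longrightarrow> drho_poly \<alpha> X p \<in> fock_ideal"
  unfolding drho_poly_def split_def
  by (intro fock_ideal.add sl_comb_ideal drho_basis_ideal)

lift_definition drho :: "real \<Rightarrow> mat2_triple \<Rightarrow> fockpoly \<Rightarrow> fockpoly" is drho_poly
  unfolding fock_rel_def by (metis drho_poly_diff drho_poly_ideal)

definition in_z1 :: "complex poly \<Rightarrow> superpoly" where "in_z1 p = SP [:p:] 0 0 0"

definition fock_of_poly :: "complex poly^4 \<Rightarrow> fockpoly" where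
  "fock_of_poly f = fock_class
     (in_z1 (f $ 1) + in_z1 (f $ 2) * z2 + in_z1 (f $ 3) * z3 + in_z1 (f $ 4) * z4)"

text \<open>The classes of \<open>z1^k\<close>, \<open>z1^k z2\<close>, \<open>z1^k z3\<close>, \<open>z1^k z4\<close> form a basis.\<close>

lemma bij_fock_of_poly: "bij fock_of_poly"
proof (rule bijI)
  show "inj fock_of_poly"
    by (rule injI) (simp add: fock_of_poly_def fock_class_eq_iff fock_ideal_iff in_z1_def
        z2_def z3_def z4_def vec_eq_iff forall_4)
  show "surj fock_of_poly"
  proof (rule surjI)
    fix u :: fockpoly
    let ?g = "\<lambda>p. vector [coeff (sp0 p) 0, coeff (sp0 p) (Suc 0) - [:0, 2:] * coeff (sp34 p) 0,
        coeff (sp3 p) 0, coeff (sp4 p) 0] :: complex poly^4"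
    have v4: "(vector [a, b, c, d] :: complex poly^4) $ 1 = a"
      "(vector [a, b, c, d] :: complex poly^4) $ 2 = b"
      "(vector [a, b, c, d] :: complex poly^4) $ 3 = c"
      "(vector [a, b, c, d] :: complex poly^4) $ 4 = d" for a b c d
      by (simp_all add: vector_def)
    have "fock_of_poly (?g p) = fock_class p" for p
      unfolding fock_of_poly_def fock_class_eq_iff fock_ideal_iff v4
      by (simp add: in_z1_def z2_def z3_def z4_def coeff_1_mult coeff_mult_0)
    moreover have "fock_class (rep_fockpoly u) = u"
      unfolding fock_class_def by (simp add: Quotient3_abs_rep[OF Quotient3_fockpoly])
    ultimately show "fock_of_poly (?g (rep_fockpoly u)) = u" by metis
  qed
qed


section \<open>The Fock space\<close>

text \<open>\<open>f = f1(z1) + f2(z1) z2 + f3(z1) z3 + f4(z1) z4\<close> is encoded as the column of the four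
  formal power series \<open>fi\<close>.\<close>

type_synonym fock = "complex fps^4"

definition fock_embed :: "fockpoly \<Rightarrow> fock" where
  "fock_embed u = (\<chi> i. fps_of_poly (inv fock_of_poly u $ i))"

text \<open>The summands of the inner product for which the basis is orthogonal with
  \<open>|z1^k|^2 = |z1^k z2|^2 = k! |(-\<alpha>)_k|\<close> and \<open>|z1^k z3|^2 = |z1^k z4|^2 = 2 k! |(-\<alpha>)_(k+1)|\<close>.\<close>

definition fock_term :: "real \<Rightarrow> fock \<Rightarrow> fock \<Rightarrow> nat \<Rightarrow> complex" where
  "fock_term \<alpha> f g k =
     of_real (fact k * \<bar>pochhammer (-\<alpha>) k\<bar>) *
       (\<Sum>i\<in>{1, 2}. fps_nth (f $ i) k * cnj (fps_nth (g $ i) k)) +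
     of_real (2 * fact k * \<bar>pochhammer (-\<alpha>) (Suc k)\<bar>) *
       (\<Sum>i\<in>{3, 4}. fps_nth (f $ i) k * cnj (fps_nth (g $ i) k))"

text \<open>The completion, realised as the series of finite norm (the weights are positive for
  \<open>\<alpha> \<notin> \<nat>\<close>, and \<open>fock_term \<alpha> f f k\<close> is real and nonnegative).\<close>

definition fock_space :: "real \<Rightarrow> fock set" where
  "fock_space \<alpha> = {f. summable (fock_term \<alpha> f f)}"

definition fock_inner :: "real \<Rightarrow> fock \<Rightarrow> fock \<Rightarrow> complex" where
  "fock_inner \<alpha> f g = (\<Sum>k. fock_term \<alpha> f g k)"

definition fock_norm :: "real \<Rightarrow> fock \<Rightarrow> real" where
  "fock_norm \<alpha> f = sqrt (Re (fock_inner \<alpha> f f))"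

definition fock_bounded_op :: "real \<Rightarrow> (fock \<Rightarrow> fock) \<Rightarrow> bool" where
  "fock_bounded_op \<alpha> T \<longleftrightarrow>
     (\<forall>f\<in>fock_space \<alpha>. T f \<in> fock_space \<alpha>) \<and>
     (\<forall>f\<in>fock_space \<alpha>. \<forall>g\<in>fock_space \<alpha>. T (f + g) = T f + T g) \<and>
     (\<forall>c. \<forall>f\<in>fock_space \<alpha>. T (fps_const c *s f) = fps_const c *s T f) \<and>
     (\<exists>C. \<forall>f\<in>fock_space \<alpha>. fock_norm \<alpha> (T f) \<le> C * fock_norm \<alpha> f)"


section \<open>The integrated action\<close>

text \<open>\<open>exp (t D)\<close> on the completion, for an operator \<open>D\<close> of the polynomial Fock space that may be
  unbounded: the strongly continuous one-parameter group of bounded operators that is given on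
  polynomials, for small \<open>t\<close>, by the norm-convergent exponential series. For \<open>\<alpha> \<notin> \<nat>\<close> at most
  one such group exists, because polynomials are dense. Only small \<open>t\<close> is required, since polynomials need not be
  entire vectors (they are not for \<open>drho (0, slH, 0)\<close>).\<close>

definition fock_exp_group ::
  "real \<Rightarrow> (fockpoly \<Rightarrow> fockpoly) \<Rightarrow> (real \<Rightarrow> fock \<Rightarrow> fock) \<Rightarrow> bool" where
  "fock_exp_group \<alpha> D U \<longleftrightarrow>
     (\<forall>t. fock_bounded_op \<alpha> (U t)) \<and>
     (\<forall>f\<in>fock_space \<alpha>. U 0 f = f) \<and>
     (\<forall>s t. \<forall>f\<in>fock_space \<alpha>. U (s + t) f = U s (U t f)) \<and>
     (\<forall>f\<in>fock_space \<alpha>. ((\<lambda>t. fock_norm \<alpha> (U t f - f)) \<longlongrightarrow> 0) (at 0)) \<and>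
     (\<exists>\<epsilon>>0. \<forall>t. \<bar>t\<bar> < \<epsilon> \<longrightarrow> (\<forall>u.
        (\<lambda>N. fock_norm \<alpha>
          ((\<Sum>n<N. fps_const (of_real (t ^ n / fact n)) *s fock_embed ((D ^^ n) u))
             - U t (fock_embed u))) \<longlonglongrightarrow> 0))"

definition fock_exp :: "real \<Rightarrow> (fockpoly \<Rightarrow> fockpoly) \<Rightarrow> fock \<Rightarrow> fock" where
  "fock_exp \<alpha> D f = (THE g. \<exists>U. fock_exp_group \<alpha> D U \<and> g = U 1 f)"

text \<open>\<open>rho0 \<alpha> X\<close> is the operator \<open>\<rho>\<^sub>0(exp X)\<close>. It is indexed by \<open>X\<close> because it is not a function of
  the matrix \<open>exp X\<close> in general: for \<open>X = (0, 2 * pi * (slF - slE), 0)\<close>, where \<open>exp X\<close> is the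
  identity, the operator is multiplication by \<open>cis (2 * pi * \<alpha>)\<close>.\<close>

definition rho0 :: "real \<Rightarrow> mat2_triple \<Rightarrow> fock \<Rightarrow> fock" where
  "rho0 \<alpha> X f = fock_exp \<alpha> (drho \<alpha> X) f"

definition mat_exp :: "mat2 \<Rightarrow> mat2" where
  "mat_exp X = (\<Sum>n. (1 / fact n) *\<^sub>R ((\<lambda>Y. X ** Y) ^^ n) (mat 1))"

definition group_exp :: "mat2_triple \<Rightarrow> mat2_triple" where
  "group_exp X = (case X of (X1, X2, X3) \<Rightarrow> (mat_exp X1, mat_exp X2, mat_exp X3))"

definition rotK :: "real \<Rightarrow> mat2" where
  "rotK k = vector [vector [cos k, - sin k], vector [sin k, cos k]]"

definition diagA :: "real \<Rightarrow> mat2" where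
  "diagA a = vector [vector [exp a, 0], vector [0, exp (- a)]]"


section \<open>Matrices of operators on power series\<close>

definition euler :: "complex fps \<Rightarrow> complex fps" where
  "euler f = fps_X * fps_deriv f"

definition scal :: "complex \<Rightarrow> complex fps \<Rightarrow> complex fps" where
  "scal c f = fps_const c * f"

text \<open>Exponential series of an operator on power series, summed coefficientwise.\<close>

definition fps_op_exp :: "(complex fps \<Rightarrow> complex fps) \<Rightarrow> complex fps \<Rightarrow> complex fps" where
  "fps_op_exp T f = Abs_fps (\<lambda>n. \<Sum>j. fps_nth ((T ^^ j) f) n / fact j)"

definition op_matrix_apply :: "(complex fps \<Rightarrow> complex fps)^4^4 \<Rightarrow> fock \<Rightarrow> fock"
    (infixr \<open>\<odot>\<close> 70) where
  "M \<odot> f = (\<chi> i. \<Sum>j\<in>UNIV. (M $ i $ j) (f $ j))"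

end

theory Submission
  imports Defs
begin

text \<open>Write \<open>v\<close> for the vector of the four coefficients of degree \<open>k\<close> of an element of the Fock space.
  In each of the five cases the generator preserves the degree and acts on \<open>v\<close> as
  \<open>\<Sum>l. \<lambda>\<^sub>k\<^sub>,\<^sub>l P\<^sub>l\<close>, where the \<open>P\<^sub>l\<close> are complementary orthogonal idempotent matrices independent of
  \<open>k\<close> and \<open>Re \<lambda>\<^sub>k\<^sub>,\<^sub>l\<close> is bounded. The \<open>P\<^sub>l\<close> preserve the blocks \<open>{1, 2}\<close> and \<open>{3, 4}\<close>, on which the
  weight of the inner product is constant, so \<open>\<Sum>l. exp (t \<lambda>\<^sub>k\<^sub>,\<^sub>l) P\<^sub>l\<close> is bounded uniformly in \<open>k\<close>
  and defines the required strongly continuous group. Two groups with the same generator agree for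
  small \<open>t\<close> on polynomials, hence by density on the whole space, hence for all \<open>t\<close>.\<close>

section \<open>Coordinates and norms of complex vectors\<close>

lemma vector_4 [simp]:
  "(vector [a, b, c, d] :: 'a::zero^4) $ 1 = a"
  "(vector [a, b, c, d] :: 'a::zero^4) $ 2 = b"
  "(vector [a, b, c, d] :: 'a::zero^4) $ 3 = c"
  "(vector [a, b, c, d] :: 'a::zero^4) $ 4 = d"
  by (simp_all add: vector_def)

lemma norm_vector_smult: "norm (c *s v) = cmod c * norm v" for v :: "complex^'n"
  by (simp add: norm_vec_def norm_mult L2_set_right_distrib)

lemma power2_norm_sum_le: "(norm (a + b))\<^sup>2 \<le> 2 * (norm a)\<^sup>2 + 2 * (norm b)\<^sup>2"
  for a b :: "'a::real_normed_vector"
proof -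
  have "(norm (a + b))\<^sup>2 \<le> (norm a + norm b)\<^sup>2"
    by (simp add: norm_triangle_ineq power_mono)
  also have "\<dots> \<le> 2 * (norm a)\<^sup>2 + 2 * (norm b)\<^sup>2"
    using sum_squares_bound[of "norm a" "norm b"] by (simp add: power2_sum)
  finally show ?thesis .
qed

section \<open>Homogeneous components of the Fock space\<close>

text \<open>The grading is by the power of z1, not by total degree: z1^k, z1^k z2, z1^k z3 and z1^k
  z4 form one component. Operators that exchange 1 and z2, such as \<open>drho_H3\<close>, therefore
  still preserve it.\<close>

definition fock_coeff :: "nat \<Rightarrow> fock \<Rightarrow> complex^4" where
  "fock_coeff k f = (\<chi> i. fps_nth (f $ i) k)"

definition fock_weight :: "real \<Rightarrow> nat \<Rightarrow> 4 \<Rightarrow> real" where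
  "fock_weight \<alpha> k i = (if i = 1 \<or> i = 2 then fact k * \<bar>pochhammer (-\<alpha>) k\<bar>
     else 2 * fact k * \<bar>pochhammer (-\<alpha>) (Suc k)\<bar>)"

text \<open>Passage to coordinates in the orthonormalized basis. It turns the weighted norm of a
  component into the Euclidean one, so the triangle inequality and operator norms on
  \<open>complex^4\<close> apply.\<close>

definition fock_scale :: "real \<Rightarrow> nat \<Rightarrow> complex^4 \<Rightarrow> complex^4" where
  "fock_scale \<alpha> k v = (\<chi> i. of_real (sqrt (fock_weight \<alpha> k i)) * v $ i)"

definition coeff_norm :: "real \<Rightarrow> nat \<Rightarrow> complex^4 \<Rightarrow> real" where
  "coeff_norm \<alpha> k v = norm (fock_scale \<alpha> k v)"

lemma fock_eqI: "(\<And>k. fock_coeff k f = fock_coeff k g) \<Longrightarrow> f = g"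
  by (simp add: fock_coeff_def vec_eq_iff fps_eq_iff)

lemma fock_coeff_simps [simp]:
  "fock_coeff k (f + g) = fock_coeff k f + fock_coeff k g"
  "fock_coeff k (f - g) = fock_coeff k f - fock_coeff k g"
  "fock_coeff k (fps_const c *s f) = c *s fock_coeff k f"
  "fock_coeff k 0 = 0"
  by (simp_all add: fock_coeff_def vec_eq_iff)

lemma fock_coeff_sum: "fock_coeff k (sum f A) = (\<Sum>a\<in>A. fock_coeff k (f a))"
  by (induction A rule: infinite_finite_induct) simp_all

lemma fock_weight_nonneg: "0 \<le> fock_weight \<alpha> k i"
  by (simp add: fock_weight_def)

text \<open>The Pochhammer symbol of -\<alpha> vanishes only if \<alpha> is a natural number.
  Positivity of all weights makes \<open>coeff_norm\<close> definite, which is where uniqueness of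
  limits comes from.\<close>

lemma fock_weight_pos:
  assumes "\<alpha> \<notin> \<nat>" shows "0 < fock_weight \<alpha> k i"
proof -
  have "pochhammer (-\<alpha>) n \<noteq> 0" for n
    using assms by (auto simp: pochhammer_eq_0_iff)
  then show ?thesis by (auto simp: fock_weight_def)
qed

lemma fock_scale_simps [simp]:
  "fock_scale \<alpha> k (v + w) = fock_scale \<alpha> k v + fock_scale \<alpha> k w"
  "fock_scale \<alpha> k (v - w) = fock_scale \<alpha> k v - fock_scale \<alpha> k w"
  "fock_scale \<alpha> k (c *s v) = c *s fock_scale \<alpha> k v"
  "fock_scale \<alpha> k 0 = 0"
  by (simp_all add: fock_scale_def vec_eq_iff algebra_simps)

lemma fock_scale_sum: "fock_scale \<alpha> k (sum f A) = (\<Sum>a\<in>A. fock_scale \<alpha> k (f a))"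
  by (induction A rule: infinite_finite_induct) simp_all

lemma coeff_norm_nonneg [simp]: "0 \<le> coeff_norm \<alpha> k v"
  by (simp add: coeff_norm_def)

lemma coeff_norm_0 [simp]: "coeff_norm \<alpha> k 0 = 0"
  by (simp add: coeff_norm_def)

lemma coeff_norm_eq_0:
  assumes "\<alpha> \<notin> \<nat>" "coeff_norm \<alpha> k v = 0" shows "v = 0"
  using assms(2) fock_weight_pos[OF assms(1)]
  by (simp add: coeff_norm_def fock_scale_def vec_eq_iff less_imp_neq[symmetric])

lemma fock_term_eq: "fock_term \<alpha> f f k = of_real ((coeff_norm \<alpha> k (fock_coeff k f))\<^sup>2)"
proof -
  have "(coeff_norm \<alpha> k v)\<^sup>2 = (\<Sum>i\<in>UNIV. fock_weight \<alpha> k i * (cmod (v $ i))\<^sup>2)" for v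
    by (simp add: coeff_norm_def norm_vec_def L2_set_def sum_nonneg fock_scale_def norm_mult
        power_mult_distrib fock_weight_nonneg)
  then show ?thesis
    by (simp add: fock_term_def sum_4 fock_weight_def fock_coeff_def complex_norm_square[symmetric] distrib_left
        mult.assoc del: of_real_power)
qed

lemma fock_space_iff: "f \<in> fock_space \<alpha> \<longleftrightarrow> summable (\<lambda>k. (coeff_norm \<alpha> k (fock_coeff k f))\<^sup>2)"
proof -
  have "fock_term \<alpha> f f = (\<lambda>k. of_real ((coeff_norm \<alpha> k (fock_coeff k f))\<^sup>2))"
    by (rule ext) (rule fock_term_eq)
  then show ?thesis by (simp add: fock_space_def summable_of_real_iff del: of_real_power)
qed

lemma fock_norm_eq:
  "f \<in> fock_space \<alpha> \<Longrightarrow> fock_norm \<alpha> f = sqrt (\<Sum>k. (coeff_norm \<alpha> k (fock_coeff k f))\<^sup>2)"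
  by (simp add: fock_space_iff fock_norm_def fock_inner_def fock_term_eq suminf_of_real[symmetric]
      del: of_real_power)

lemma fock_norm_nonneg: "f \<in> fock_space \<alpha> \<Longrightarrow> 0 \<le> fock_norm \<alpha> f"
  by (simp add: fock_norm_eq fock_space_iff suminf_nonneg)

lemma coeff_norm_le_fock_norm:
  assumes "f \<in> fock_space \<alpha>"
  shows "coeff_norm \<alpha> k (fock_coeff k f) \<le> fock_norm \<alpha> f"
proof -
  have "(\<Sum>j\<in>{k}. (coeff_norm \<alpha> j (fock_coeff j f))\<^sup>2) \<le> (\<Sum>j. (coeff_norm \<alpha> j (fock_coeff j f))\<^sup>2)"
    using assms by (intro sum_le_suminf) (auto simp: fock_space_iff)
  then show ?thesis
    by (simp add: fock_norm_eq assms real_le_rsqrt)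
qed

text \<open>A bound on components with a constant independent of k sums to a bound in norm. Both the
  boundedness of the flow and the convergence of its exponential series are obtained this
  way.\<close>

lemma fock_space_dominated:
  assumes "f \<in> fock_space \<alpha>" "0 \<le> C"
    and le: "\<And>k. coeff_norm \<alpha> k (fock_coeff k g) \<le> C * coeff_norm \<alpha> k (fock_coeff k f)"
  shows "g \<in> fock_space \<alpha>" "fock_norm \<alpha> g \<le> C * fock_norm \<alpha> f"
proof -
  let ?F = "\<lambda>k. (coeff_norm \<alpha> k (fock_coeff k f))\<^sup>2"
  have F: "summable ?F" using assms(1) by (simp add: fock_space_iff)
  have le2: "(coeff_norm \<alpha> k (fock_coeff k g))\<^sup>2 \<le> C\<^sup>2 * ?F k" for k
    using power_mono[OF le, of k 2] by (simp add: power_mult_distrib)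
  have g: "summable (\<lambda>k. (coeff_norm \<alpha> k (fock_coeff k g))\<^sup>2)"
    by (rule summable_comparison_test'[OF summable_mult[OF F, of "C\<^sup>2"], of 0]) (use le2 in auto)
  then show gs: "g \<in> fock_space \<alpha>" by (simp add: fock_space_iff)
  have "(\<Sum>k. (coeff_norm \<alpha> k (fock_coeff k g))\<^sup>2) \<le> (\<Sum>k. C\<^sup>2 * ?F k)"
    by (intro suminf_le le2 g summable_mult F)
  also have "\<dots> = C\<^sup>2 * (\<Sum>k. ?F k)" by (rule suminf_mult[OF F])
  finally have "sqrt (\<Sum>k. (coeff_norm \<alpha> k (fock_coeff k g))\<^sup>2) \<le> sqrt (C\<^sup>2 * (\<Sum>k. ?F k))"
    by (rule real_sqrt_le_mono)
  then show "fock_norm \<alpha> g \<le> C * fock_norm \<alpha> f"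
    using \<open>0 \<le> C\<close> by (simp add: fock_norm_eq gs assms(1) real_sqrt_mult)
qed

section \<open>Linear structure of the Fock space and uniqueness of norm limits\<close>

lemma fock_space_add:
  assumes "f \<in> fock_space \<alpha>" "g \<in> fock_space \<alpha>"
  shows "f + g \<in> fock_space \<alpha>"
  unfolding fock_space_iff
proof (rule summable_comparison_test'[of _ 0])
  show "summable (\<lambda>k. 2 * (coeff_norm \<alpha> k (fock_coeff k f))\<^sup>2 + 2 * (coeff_norm \<alpha> k (fock_coeff k g))\<^sup>2)"
    using assms by (intro summable_add summable_mult) (simp_all add: fock_space_iff)
qed (simp add: coeff_norm_def power2_norm_sum_le)

lemma fock_space_smult: "f \<in> fock_space \<alpha> \<Longrightarrow> fps_const c *s f \<in> fock_space \<alpha>"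
  by (rule fock_space_dominated(1)[of f _ "cmod c"]) (simp_all add: coeff_norm_def norm_vector_smult)

lemma fock_space_diff:
  assumes "f \<in> fock_space \<alpha>" "g \<in> fock_space \<alpha>"
  shows "f - g \<in> fock_space \<alpha>"
proof -
  have "f - g = f + fps_const (-1) *s g" by (rule fock_eqI) (simp add: vec_eq_iff)
  then show ?thesis by (simp only: fock_space_add fock_space_smult assms)
qed

lemma fock_space_finite_support:
  assumes "\<And>k. k \<ge> n \<Longrightarrow> fock_coeff k f = 0" shows "f \<in> fock_space \<alpha>"
  unfolding fock_space_iff by (rule summable_finite[of "{..<n}"]) (auto simp: assms not_less)

lemma fock_space_0: "0 \<in> fock_space \<alpha>"
  by (rule fock_space_finite_support[of 0]) simp

lemma fock_space_sum: "(\<And>a. a \<in> A \<Longrightarrow> F a \<in> fock_space \<alpha>) \<Longrightarrow> sum F A \<in> fock_space \<alpha>"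
  by (induction A rule: infinite_finite_induct) (simp_all add: fock_space_0 fock_space_add)

lemma coeff_norm_tendsto_of_fock_norm:
  assumes "\<And>n. X n \<in> fock_space \<alpha>" "a \<in> fock_space \<alpha>"
    and lim: "(\<lambda>n. fock_norm \<alpha> (X n - a)) \<longlonglongrightarrow> 0"
  shows "(\<lambda>n. coeff_norm \<alpha> k (fock_coeff k (X n) - fock_coeff k a)) \<longlonglongrightarrow> 0"
proof (rule tendsto_sandwich[OF _ _ tendsto_const lim])
  show "\<forall>\<^sub>F n in sequentially. coeff_norm \<alpha> k (fock_coeff k (X n) - fock_coeff k a) \<le> fock_norm \<alpha> (X n - a)"
    using coeff_norm_le_fock_norm[OF fock_space_diff[OF assms(1,2)]] by simp
qed simp

text \<open>Norm convergence forces convergence of every component, and there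
  \<open>coeff_norm\<close> is a genuine norm. Comparing components avoids a triangle inequality for
  \<open>fock_norm\<close> itself.\<close>

lemma fock_norm_limit_unique:
  assumes "\<alpha> \<notin> \<nat>" "\<And>n. X n \<in> fock_space \<alpha>" "a \<in> fock_space \<alpha>" "b \<in> fock_space \<alpha>"
    and "(\<lambda>n. fock_norm \<alpha> (X n - a)) \<longlonglongrightarrow> 0" "(\<lambda>n. fock_norm \<alpha> (X n - b)) \<longlonglongrightarrow> 0"
  shows "a = b"
proof (rule fock_eqI)
  fix k
  let ?d = "\<lambda>n c. coeff_norm \<alpha> k (fock_coeff k (X n) - fock_coeff k c)"
  have "(\<lambda>n. ?d n a + ?d n b) \<longlonglongrightarrow> 0"
    using tendsto_add[OF coeff_norm_tendsto_of_fock_norm[OF assms(2,3,5)]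
      coeff_norm_tendsto_of_fock_norm[OF assms(2,4,6)]] by simp
  moreover have "coeff_norm \<alpha> k (fock_coeff k a - fock_coeff k b) \<le> ?d n a + ?d n b" for n
    using norm_triangle_ineq4[of "fock_scale \<alpha> k (fock_coeff k (X n) - fock_coeff k b)"
        "fock_scale \<alpha> k (fock_coeff k (X n) - fock_coeff k a)"]
    by (simp add: coeff_norm_def)
  ultimately have "coeff_norm \<alpha> k (fock_coeff k a - fock_coeff k b) \<le> 0"
    by (meson LIMSEQ_le_const)
  then show "fock_coeff k a = fock_coeff k b"
    using coeff_norm_eq_0[OF assms(1)] by (metis coeff_norm_nonneg eq_iff_diff_eq_0 order_antisym)
qed

section \<open>Density of polynomials and uniqueness of the one-parameter group\<close>

text \<open>Built from polynomials rather than by cutting off the series directly, so that it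
  visibly lies in the range of \<open>fock_embed\<close>.\<close>

definition fock_truncate :: "nat \<Rightarrow> fock \<Rightarrow> fock" where
  "fock_truncate n f = (\<chi> i. fps_of_poly (poly_of_list (map (fps_nth (f $ i)) [0..<n])))"

lemma fock_coeff_truncate: "fock_coeff k (fock_truncate n f) = (if k < n then fock_coeff k f else 0)"
  by (simp add: fock_truncate_def fock_coeff_def vec_eq_iff nth_default_def)

lemma fock_embed_of_poly: "fock_embed (fock_of_poly p) = (\<chi> i. fps_of_poly (p $ i))"
  by (simp add: fock_embed_def bij_fock_of_poly bij_is_inj)

lemma fock_truncate_in_range: "\<exists>u. fock_truncate n f = fock_embed u"
proof -
  have "fock_truncate n f =
      fock_embed (fock_of_poly (\<chi> i. poly_of_list (map (fps_nth (f $ i)) [0..<n])))"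
    by (simp add: fock_embed_of_poly fock_truncate_def)
  then show ?thesis ..
qed

lemma fock_embed_finite_support: "\<exists>n. \<forall>k\<ge>n. fock_coeff k (fock_embed u) = 0"
proof -
  define p where "p = inv fock_of_poly u"
  have "degree (p $ i) \<le> (\<Sum>i\<in>UNIV. degree (p $ i))" for i
    by (rule member_le_sum) auto
  then have "coeff (p $ i) k = 0" if "k \<ge> Suc (\<Sum>i\<in>UNIV. degree (p $ i))" for i k
    using that by (intro coeff_eq_0) (meson Suc_le_eq order_le_less_trans)
  then show ?thesis
    unfolding fock_coeff_def fock_embed_def p_def[symmetric]
    by (intro exI[of _ "Suc (\<Sum>i\<in>UNIV. degree (p $ i))"]) (simp add: vec_eq_iff)
qed

lemma fock_embed_in_fock_space: "fock_embed u \<in> fock_space \<alpha>"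
  using fock_embed_finite_support fock_space_finite_support by metis

lemma fock_truncate_in_fock_space: "fock_truncate n f \<in> fock_space \<alpha>"
  using fock_truncate_in_range fock_embed_in_fock_space by metis

text \<open>Density of polynomials: the squared distance to the truncation is a tail of the
  convergent series for the squared norm.\<close>

lemma fock_truncate_tendsto:
  assumes f: "f \<in> fock_space \<alpha>"
  shows "(\<lambda>n. fock_norm \<alpha> (f - fock_truncate n f)) \<longlonglongrightarrow> 0"
proof -
  let ?F = "\<lambda>k. (coeff_norm \<alpha> k (fock_coeff k f))\<^sup>2"
  have F: "summable ?F" using f by (simp add: fock_space_iff)
  have "fock_norm \<alpha> (f - fock_truncate n f) = sqrt (\<Sum>k. ?F (k + n))" for n
  proof -
    let ?G = "\<lambda>k. (coeff_norm \<alpha> k (fock_coeff k (f - fock_truncate n f)))\<^sup>2"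
    have d: "f - fock_truncate n f \<in> fock_space \<alpha>"
      by (intro fock_space_diff f fock_truncate_in_fock_space)
    then have "suminf ?G = (\<Sum>k. ?G (k + n)) + sum ?G {..<n}"
      by (intro suminf_split_initial_segment) (simp add: fock_space_iff)
    also have "sum ?G {..<n} = 0"
      by (intro sum.neutral) (simp add: fock_coeff_truncate)
    finally show ?thesis by (simp add: fock_norm_eq[OF d] fock_coeff_truncate)
  qed
  moreover have "(\<lambda>n. \<Sum>k. ?F (k + n)) \<longlonglongrightarrow> 0"
    using suminf_exist_split2[OF F] .
  ultimately show ?thesis
    using tendsto_real_sqrt[of "\<lambda>n. \<Sum>k. ?F (k + n)" 0 sequentially] by simp
qed

section \<open>Bounded operators and uniqueness of the group\<close>

lemma fock_bounded_opD:
  assumes "fock_bounded_op \<alpha> T"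
  shows "f \<in> fock_space \<alpha> \<Longrightarrow> T f \<in> fock_space \<alpha>"
    "f \<in> fock_space \<alpha> \<Longrightarrow> g \<in> fock_space \<alpha> \<Longrightarrow> T (f + g) = T f + T g"
    "\<exists>C. \<forall>f\<in>fock_space \<alpha>. fock_norm \<alpha> (T f) \<le> C * fock_norm \<alpha> f"
  using assms unfolding fock_bounded_op_def by blast+

lemma fock_exp_groupD:
  assumes "fock_exp_group \<alpha> D U"
  shows "fock_bounded_op \<alpha> (U t)"
    "f \<in> fock_space \<alpha> \<Longrightarrow> U 0 f = f"
    "f \<in> fock_space \<alpha> \<Longrightarrow> U (s + t) f = U s (U t f)"
    "\<exists>\<epsilon>>0. \<forall>t. \<bar>t\<bar> < \<epsilon> \<longrightarrow> (\<forall>u. (\<lambda>N. fock_norm \<alpha>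
       ((\<Sum>n<N. fps_const (of_real (t ^ n / fact n)) *s fock_embed ((D ^^ n) u))
         - U t (fock_embed u))) \<longlonglongrightarrow> 0)"
  using assms unfolding fock_exp_group_def by blast+

lemma fock_bounded_op_diff:
  assumes "fock_bounded_op \<alpha> T" "f \<in> fock_space \<alpha>" "g \<in> fock_space \<alpha>"
  shows "T (f - g) = T f - T g"
proof -
  have "f - g \<in> fock_space \<alpha>" using assms(2,3) by (rule fock_space_diff)
  then have "T ((f - g) + g) = T (f - g) + T g"
    by (rule fock_bounded_opD(2)[OF assms(1) _ assms(3)])
  then show ?thesis by simp
qed

text \<open>By linearity and boundedness the error is at most C times the distance from f to its
  truncation. Hence a bounded operator is determined by its values on polynomials.\<close>

lemma fock_bounded_op_tendsto:
  assumes T: "fock_bounded_op \<alpha> T" and f: "f \<in> fock_space \<alpha>"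
  shows "(\<lambda>n. fock_norm \<alpha> (T (fock_truncate n f) - T f)) \<longlonglongrightarrow> 0"
proof -
  obtain C where C: "\<And>g. g \<in> fock_space \<alpha> \<Longrightarrow> fock_norm \<alpha> (T g) \<le> C * fock_norm \<alpha> g"
    using fock_bounded_opD(3)[OF T] by blast
  have mem: "fock_truncate n f - f \<in> fock_space \<alpha>" for n
    by (intro fock_space_diff f fock_truncate_in_fock_space)
  have eq: "fock_norm \<alpha> (fock_truncate n f - f) = fock_norm \<alpha> (f - fock_truncate n f)" for n
    unfolding fock_norm_eq[OF mem]
      fock_norm_eq[OF fock_space_diff[OF f fock_truncate_in_fock_space]]
    by (simp add: coeff_norm_def norm_minus_commute)
  have "(\<lambda>n. C * fock_norm \<alpha> (f - fock_truncate n f)) \<longlonglongrightarrow> 0"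
    using tendsto_mult_right_zero[OF fock_truncate_tendsto[OF f]] .
  then show ?thesis
  proof (rule tendsto_sandwich[rotated 3, OF _ ])
    show "\<forall>\<^sub>F n in sequentially. 0 \<le> fock_norm \<alpha> (T (fock_truncate n f) - T f)"
      by (intro always_eventually allI fock_norm_nonneg fock_space_diff fock_bounded_opD(1)[OF T f]
          fock_bounded_opD(1)[OF T fock_truncate_in_fock_space])
    show "\<forall>\<^sub>F n in sequentially. fock_norm \<alpha> (T (fock_truncate n f) - T f)
        \<le> C * fock_norm \<alpha> (f - fock_truncate n f)"
      using C[OF mem] by (simp add: fock_bounded_op_diff[OF T fock_truncate_in_fock_space f] eq)
  qed simp
qed

text \<open>On polynomials both groups are limits of the same partial sums whenever |t| lies below
  both radii. Density then extends the equality to the whole space.\<close>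

lemma fock_exp_group_agree_small:
  assumes \<alpha>: "\<alpha> \<notin> \<nat>" and U: "fock_exp_group \<alpha> D U" and V: "fock_exp_group \<alpha> D V"
  obtains \<epsilon> where "\<epsilon> > 0" "\<And>t f. \<bar>t\<bar> < \<epsilon> \<Longrightarrow> f \<in> fock_space \<alpha> \<Longrightarrow> U t f = V t f"
proof -
  let ?S = "\<lambda>t u N. \<Sum>n<N. fps_const (complex_of_real (t ^ n / fact n)) *s fock_embed ((D ^^ n) u)"
  note bdd = fock_exp_groupD(1)
  have mem: "W t f \<in> fock_space \<alpha>" if "fock_exp_group \<alpha> D W" "f \<in> fock_space \<alpha>" for W t f
    by (rule fock_bounded_opD(1)[OF bdd[OF that(1)] that(2)])
  obtain \<epsilon>1 where \<epsilon>1: "\<epsilon>1 > 0"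
    "\<And>t u. \<bar>t\<bar> < \<epsilon>1 \<Longrightarrow> (\<lambda>N. fock_norm \<alpha> (?S t u N - U t (fock_embed u))) \<longlonglongrightarrow> 0"
    using fock_exp_groupD(4)[OF U] by blast
  obtain \<epsilon>2 where \<epsilon>2: "\<epsilon>2 > 0"
    "\<And>t u. \<bar>t\<bar> < \<epsilon>2 \<Longrightarrow> (\<lambda>N. fock_norm \<alpha> (?S t u N - V t (fock_embed u))) \<longlonglongrightarrow> 0"
    using fock_exp_groupD(4)[OF V] by blast
  show ?thesis
  proof
    show "min \<epsilon>1 \<epsilon>2 > 0" using \<epsilon>1 \<epsilon>2 by simp
    fix t f assume t: "\<bar>t\<bar> < min \<epsilon>1 \<epsilon>2" and f: "f \<in> fock_space \<alpha>"
    have S: "?S t u N \<in> fock_space \<alpha>" for u N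
      by (intro fock_space_sum fock_space_smult fock_embed_in_fock_space)
    have poly: "U t (fock_embed u) = V t (fock_embed u)" for u
      using t by (intro fock_norm_limit_unique[OF \<alpha> S mem[OF U] mem[OF V] \<epsilon>1(2) \<epsilon>2(2)]
          fock_embed_in_fock_space) auto
    then have "U t (fock_truncate n f) = V t (fock_truncate n f)" for n
      using fock_truncate_in_range by metis
    then have "(\<lambda>n. fock_norm \<alpha> (U t (fock_truncate n f) - V t f)) \<longlonglongrightarrow> 0"
      using fock_bounded_op_tendsto[OF bdd[OF V] f] by simp
    then show "U t f = V t f"
      by (rule fock_norm_limit_unique[OF \<alpha> mem[OF U fock_truncate_in_fock_space] mem[OF U f]
            mem[OF V f] fock_bounded_op_tendsto[OF bdd[OF U] f]])
  qed
qed

lemma fock_exp_group_funpow: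
  assumes U: "fock_exp_group \<alpha> D U" and f: "f \<in> fock_space \<alpha>"
  shows "U (real n * s) f = (U s ^^ n) f"
  by (induction n) (simp_all add: distrib_right fock_exp_groupD(2,3)[OF U] f)

text \<open>Every t is n s with s in the interval of agreement, and by the group law the operator at
  n s is the n-th iterate of the operator at s.\<close>

lemma fock_exp_group_unique:
  assumes \<alpha>: "\<alpha> \<notin> \<nat>" and U: "fock_exp_group \<alpha> D U" and V: "fock_exp_group \<alpha> D V"
    and f: "f \<in> fock_space \<alpha>"
  shows "U t f = V t f"
proof -
  obtain \<epsilon> where \<epsilon>: "\<epsilon> > 0" "\<And>t f. \<bar>t\<bar> < \<epsilon> \<Longrightarrow> f \<in> fock_space \<alpha> \<Longrightarrow> U t f = V t f"
    using fock_exp_group_agree_small[OF \<alpha> U V] by metis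
  obtain n :: nat where n: "\<bar>t\<bar> / \<epsilon> < real n" using reals_Archimedean2 by blast
  then have n0: "real n > 0" using \<epsilon>(1) by (smt (verit) divide_nonneg_pos)
  define s where "s = t / real n"
  have s: "\<bar>s\<bar> < \<epsilon>" and t: "t = real n * s"
    using n n0 \<epsilon>(1) by (simp_all add: s_def field_simps)
  \<comment> \<open>Membership is carried through the induction because the two groups are known to
    agree only on the Fock space.\<close>
  have "(U s ^^ m) f = (V s ^^ m) f \<and> (U s ^^ m) f \<in> fock_space \<alpha>" for m
  proof (induction m)
    case (Suc m)
    then show ?case
      using fock_bounded_opD(1)[OF fock_exp_groupD(1)[OF V]] \<epsilon>(2)[OF s] by auto
  qed (simp add: f)
  then show ?thesis
    unfolding t fock_exp_group_funpow[OF U f] fock_exp_group_funpow[OF V f] by blast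
qed

text \<open>Uniqueness resolves the definite description: exhibiting a single group for D suffices
  to evaluate the exponential.\<close>

lemma fock_exp_eq:
  assumes "\<alpha> \<notin> \<nat>" "fock_exp_group \<alpha> D U" "f \<in> fock_space \<alpha>"
  shows "fock_exp \<alpha> D f = U 1 f"
  unfolding fock_exp_def using assms fock_exp_group_unique by (intro the_equality) blast+

section \<open>One-parameter groups with a constant block spectral decomposition\<close>

text \<open>Orthogonality of the idempotents means only that distinct products vanish. They need not
  be Hermitian (those for K_1 are not), so the group is bounded but need not be unitary. The
  eigenvalues may depend on k, the idempotents may not.\<close>

locale fock_spectral =
  fixes P :: "(complex^4^4)^'l" and ev :: "nat \<Rightarrow> complex^'l" and R :: real
  assumes orth: "\<And>l m. P $ l ** P $ m = (if l = m then P $ l else 0)"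
    and complete: "(\<Sum>l\<in>UNIV. P $ l) = mat 1"
    and block: "\<And>l i j. P $ l $ i $ j \<noteq> 0 \<Longrightarrow> (i = 1 \<or> i = 2) = (j = 1 \<or> j = 2)"
    and Re_ev_le: "\<And>k l. \<bar>Re (ev k $ l)\<bar> \<le> R"
begin

text \<open>Functional calculus on one component: with the eigenvalues as \<open>c\<close> it is the
  generator, with their exponentials it is the group.\<close>

definition calc :: "('l \<Rightarrow> complex) \<Rightarrow> complex^4 \<Rightarrow> complex^4" where
  "calc c v = (\<Sum>l\<in>UNIV. c l *s (P $ l *v v))"

lemma P_sum: "P $ l *v (sum g A) = (\<Sum>a\<in>A. P $ l *v g a)"
  by (rule linear_sum) (rule bounded_linear.linear, rule matrix_vector_mul_bounded_linear)

lemma calc_add: "calc c (v + w) = calc c v + calc c w"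
  by (simp add: calc_def matrix_vector_right_distrib vector_add_ldistrib sum.distrib)

lemma calc_smult: "calc c (a *s v) = a *s calc c v"
  by (simp add: calc_def vector_scalar_commute vector_smult_assoc mult.commute vec.scale_sum_right)

lemma calc_0 [simp]: "calc c 0 = 0"
  by (simp add: calc_def)

lemma calc_diff_left: "calc (\<lambda>l. c l - d l) v = calc c v - calc d v"
  by (simp add: calc_def vector_sub_rdistrib sum_subtractf)

lemma calc_sum_left: "(\<Sum>n\<in>A. a n *s calc (c n) v) = calc (\<lambda>l. \<Sum>n\<in>A. a n * c n l) v"
  by (simp add: calc_def vec.scale_sum_right vector_smult_assoc vec.scale_sum_left sum.swap[of _ UNIV A])

lemma calc_1: "calc (\<lambda>l. 1) v = v"
proof -
  have "(\<Sum>l\<in>A. P $ l *v v) = (\<Sum>l\<in>A. P $ l) *v v" for A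
    by (induction A rule: infinite_finite_induct) (simp_all add: matrix_vector_mult_add_rdistrib)
  then show ?thesis by (simp add: calc_def complete)
qed

text \<open>Products of distinct idempotents vanish, so the calculus is multiplicative. Powers of
  the generator and the group law both follow.\<close>

lemma calc_calc: "calc c (calc d v) = calc (\<lambda>l. c l * d l) v"
proof -
  have "P $ l *v calc d v = d l *s (P $ l *v v)" for l
  proof -
    have "P $ l *v calc d v = (\<Sum>m\<in>UNIV. if l = m then d m *s (P $ m *v v) else 0)"
      unfolding calc_def P_sum
      by (rule sum.cong) (auto simp: vector_scalar_commute matrix_vector_mul_assoc orth)
    then show ?thesis by simp
  qed
  then show ?thesis by (simp add: calc_def vector_smult_assoc)
qed

lemma calc_funpow: "(calc c ^^ n) v = calc (\<lambda>l. c l ^ n) v"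
  by (induction n) (simp_all add: calc_1 calc_calc)

section \<open>Norm bounds uniform in the degree\<close>

definition P_bound :: real where
  "P_bound = (\<Sum>l\<in>UNIV. onorm ((*v) (P $ l)))"

lemma onorm_P_nonneg: "0 \<le> onorm ((*v) (P $ l))"
  by (rule onorm_pos_le) (rule matrix_vector_mul_bounded_linear)

lemma P_bound_nonneg: "0 \<le> P_bound"
  by (simp add: P_bound_def sum_nonneg onorm_P_nonneg)

lemma norm_calc_le:
  assumes "\<And>l. cmod (c l) \<le> B"
  shows "norm (calc c v) \<le> B * P_bound * norm v"
proof -
  have B: "0 \<le> B" using assms norm_ge_zero order_trans by blast
  have "norm (calc c v) \<le> (\<Sum>l\<in>UNIV. B * (onorm ((*v) (P $ l)) * norm v))"
    unfolding calc_def
    by (intro sum_norm_le)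
      (simp add: norm_vector_smult mult_mono assms B onorm matrix_vector_mul_bounded_linear)
  also have "\<dots> = B * P_bound * norm v"
    by (simp add: P_bound_def sum_distrib_left sum_distrib_right mult.assoc)
  finally show ?thesis .
qed

text \<open>The weight at degree k only depends on the block {1, 2} or {3, 4} of the index.\<close>

lemma fock_scale_calc: "fock_scale \<alpha> k (calc c v) = calc c (fock_scale \<alpha> k v)"
proof -
  have "fock_scale \<alpha> k (P $ l *v v) = P $ l *v fock_scale \<alpha> k v" for l
  proof -
    have "of_real (sqrt (fock_weight \<alpha> k i)) * (P $ l $ i $ j * v $ j) =
        P $ l $ i $ j * (of_real (sqrt (fock_weight \<alpha> k j)) * v $ j)" for i j
      using block[of l i j] by (cases "P $ l $ i $ j = 0") (simp_all add: fock_weight_def)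
    then show ?thesis
      unfolding fock_scale_def matrix_vector_mult_def vec_eq_iff vec_lambda_beta sum_distrib_left
      by (intro allI sum.cong refl)
  qed
  then show ?thesis by (simp add: calc_def fock_scale_sum)
qed

lemma coeff_norm_calc_le:
  assumes "\<And>l. cmod (c l) \<le> B"
  shows "coeff_norm \<alpha> k (calc c v) \<le> B * P_bound * coeff_norm \<alpha> k v"
  unfolding coeff_norm_def fock_scale_calc by (rule norm_calc_le[OF assms])

section \<open>The flow and its group properties\<close>

definition flow :: "real \<Rightarrow> fock \<Rightarrow> fock" where
  "flow t f = (\<chi> i. Abs_fps (\<lambda>k. calc (\<lambda>l. exp (of_real t * ev k $ l)) (fock_coeff k f) $ i))"

lemma fock_coeff_flow:
  "fock_coeff k (flow t f) = calc (\<lambda>l. exp (of_real t * ev k $ l)) (fock_coeff k f)"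
  by (simp add: flow_def fock_coeff_def vec_eq_iff)

text \<open>The modulus of exp z is exp (Re z), so only real parts matter. This admits the
  eigenvalues of K_2, which are purely imaginary but in general unbounded in k.\<close>

lemma norm_exp_ev_le: "cmod (exp (of_real t * ev k $ l)) \<le> exp (\<bar>t\<bar> * R)"
proof -
  have "t * Re (ev k $ l) \<le> \<bar>t\<bar> * R"
    using mult_left_mono[OF Re_ev_le, of "\<bar>t\<bar>" k l] by (metis abs_ge_zero abs_mult abs_le_D1)
  then show ?thesis by simp
qed

lemma coeff_norm_flow_le:
  "coeff_norm \<alpha> k (fock_coeff k (flow t f)) \<le> exp (\<bar>t\<bar> * R) * P_bound * coeff_norm \<alpha> k (fock_coeff k f)"
  unfolding fock_coeff_flow by (rule coeff_norm_calc_le[OF norm_exp_ev_le])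

lemma flow_bound_nonneg: "0 \<le> exp (\<bar>t\<bar> * R) * P_bound"
  by (simp add: P_bound_nonneg)

lemma flow_in_fock_space: "f \<in> fock_space \<alpha> \<Longrightarrow> flow t f \<in> fock_space \<alpha>"
  by (rule fock_space_dominated(1)[OF _ flow_bound_nonneg coeff_norm_flow_le])

lemma fock_bounded_op_flow: "fock_bounded_op \<alpha> (flow t)"
  unfolding fock_bounded_op_def
proof (intro conjI ballI allI)
  show "\<exists>C. \<forall>f\<in>fock_space \<alpha>. fock_norm \<alpha> (flow t f) \<le> C * fock_norm \<alpha> f"
    using fock_space_dominated(2)[OF _ flow_bound_nonneg coeff_norm_flow_le] by blast
qed (auto intro!: fock_eqI flow_in_fock_space simp: fock_coeff_flow calc_add calc_smult)

lemma flow_0: "flow 0 f = f"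
  by (rule fock_eqI) (simp add: fock_coeff_flow calc_1)

lemma flow_add: "flow (s + t) f = flow s (flow t f)"
  by (rule fock_eqI) (simp add: fock_coeff_flow calc_calc exp_add distrib_right)

text \<open>Dominated convergence for series (Tannery's theorem): each component of the difference
  tends to 0, and for |t| < 1 the squared component norms have a summable majorant independent of
  t.\<close>

lemma flow_continuous:
  assumes f: "f \<in> fock_space \<alpha>"
  shows "((\<lambda>t. fock_norm \<alpha> (flow t f - f)) \<longlongrightarrow> 0) (at 0)"
proof -
  let ?c = "\<lambda>k t l. exp (of_real t * ev k $ l) - 1"
  let ?a = "\<lambda>k t. (coeff_norm \<alpha> k (fock_coeff k (flow t f - f)))\<^sup>2"
  let ?M = "\<lambda>k. ((exp R + 1) * P_bound)\<^sup>2 * (coeff_norm \<alpha> k (fock_coeff k f))\<^sup>2"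
  have coeff: "fock_coeff k (flow t f - f) = calc (?c k t) (fock_coeff k f)" for k t
    by (simp add: fock_coeff_flow calc_diff_left calc_1)
  have lim: "((\<lambda>t. ?a k t) \<longlongrightarrow> 0) (at 0)" for k
  proof -
    \<comment> \<open>The sum over l stands in for the maximum of the |c l|: it dominates each of
      them and is evidently continuous in t, with value 0 at t = 0.\<close>
    have "((\<lambda>t. (\<Sum>l\<in>UNIV. cmod (?c k t l)) * P_bound * coeff_norm \<alpha> k (fock_coeff k f)) \<longlongrightarrow>
        (\<Sum>l\<in>(UNIV::'l set). cmod (exp (of_real 0 * ev k $ l) - 1)) * P_bound * coeff_norm \<alpha> k (fock_coeff k f)) (at 0)"
      by (intro tendsto_intros)
    then have *: "((\<lambda>t. (\<Sum>l\<in>UNIV. cmod (?c k t l)) * P_bound * coeff_norm \<alpha> k (fock_coeff k f)) \<longlongrightarrow> 0) (at 0)"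
      by simp
    have "coeff_norm \<alpha> k (fock_coeff k (flow t f - f))
        \<le> (\<Sum>l\<in>UNIV. cmod (?c k t l)) * P_bound * coeff_norm \<alpha> k (fock_coeff k f)" for t
      unfolding coeff by (intro coeff_norm_calc_le member_le_sum) auto
    then have "((\<lambda>t. coeff_norm \<alpha> k (fock_coeff k (flow t f - f))) \<longlongrightarrow> 0) (at 0)"
      by (intro tendsto_sandwich[OF _ _ tendsto_const *]) simp_all
    from tendsto_power[OF this, of 2] show ?thesis by simp
  qed
  have bound: "norm (?a k t) \<le> ?M k" if "\<bar>t\<bar> < 1" for k t
  proof -
    have R: "0 \<le> R" using Re_ev_le[of 0 undefined] by linarith
    have "cmod (?c k t l) \<le> exp R + 1" for l
    proof -
      have "cmod (exp (of_real t * ev k $ l)) \<le> exp R"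
        using norm_exp_ev_le[of t k l] mult_right_mono[of "\<bar>t\<bar>" 1 R] that R
        by (smt (verit) exp_le_cancel_iff mult_1)
      then show ?thesis
        using norm_triangle_ineq4[of "exp (of_real t * ev k $ l)" 1] by (simp del: norm_exp_eq_Re)
    qed
    then have "coeff_norm \<alpha> k (fock_coeff k (flow t f - f))
        \<le> (exp R + 1) * P_bound * coeff_norm \<alpha> k (fock_coeff k f)"
      unfolding coeff by (rule coeff_norm_calc_le)
    from power_mono[OF this, of 2] show ?thesis
      by (simp add: power_mult_distrib)
  qed
  have "((\<lambda>t. \<Sum>k. ?a k t) \<longlongrightarrow> (\<Sum>k. 0)) (at 0)"
  proof (rule tannerys_theorem[THEN conjunct2, THEN conjunct2])
    show "summable ?M"
      using f by (intro summable_mult) (simp add: fock_space_iff)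
    have "\<forall>\<^sub>F t::real in at 0. \<bar>t\<bar> < 1"
      by (auto simp: eventually_at intro!: exI[of _ 1])
    then have "\<forall>\<^sub>F t in at 0. \<forall>k. norm (?a k t) \<le> ?M k"
      by eventually_elim (use bound in blast)
    then show "\<forall>\<^sub>F (k, t) in sequentially \<times>\<^sub>F at 0. norm (?a k t) \<le> ?M k"
      \<comment> \<open>The majorant holds for all k at once, so the condition on k in the product
        filter can be taken to be trivially true.\<close>
      unfolding eventually_prod_filter using eventually_True by fastforce
  qed (use lim in auto)
  then have "((\<lambda>t. sqrt (\<Sum>k. ?a k t)) \<longlongrightarrow> sqrt 0) (at 0)"
    by (intro tendsto_real_sqrt) simp
  then show ?thesis
    by (simp add: fock_norm_eq fock_space_diff flow_in_fock_space f)
qed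

text \<open>On components D^n multiplies by powers of the eigenvalues, so the error is
  \<open>calc\<close> applied to the errors of scalar exponential series. A polynomial has finitely
  many nonzero components, hence no uniformity in k is required and every real t is allowed.\<close>

lemma flow_exp_series:
  assumes D: "\<And>k u. fock_coeff k (fock_embed (D u)) = calc (\<lambda>l. ev k $ l) (fock_coeff k (fock_embed u))"
  shows "(\<lambda>N. fock_norm \<alpha> ((\<Sum>n<N. fps_const (of_real (t ^ n / fact n)) *s fock_embed ((D ^^ n) u))
           - flow t (fock_embed u))) \<longlonglongrightarrow> 0"
proof -
  let ?S = "\<lambda>N. \<Sum>n<N. fps_const (complex_of_real (t ^ n / fact n)) *s fock_embed ((D ^^ n) u)"
  define c where "c N k l = (\<Sum>n<N. complex_of_real (t ^ n / fact n) * (ev k $ l) ^ n)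
      - exp (of_real t * ev k $ l)" for N k l
  have Dn: "fock_coeff k (fock_embed ((D ^^ n) u)) = calc (\<lambda>l. (ev k $ l) ^ n) (fock_coeff k (fock_embed u))" for n k
    unfolding calc_funpow[symmetric] by (induction n) (simp_all add: D)
  have coeff: "fock_coeff k (?S N - flow t (fock_embed u)) = calc (c N k) (fock_coeff k (fock_embed u))" for N k
    by (simp add: c_def[abs_def] fock_coeff_sum Dn fock_coeff_flow calc_diff_left calc_sum_left del: of_real_divide of_real_power)
  have c_lim: "(\<lambda>N. c N k l) \<longlonglongrightarrow> 0" for k l
  proof -
    have "(\<lambda>n. complex_of_real (t ^ n / fact n) * (ev k $ l) ^ n) sums exp (of_real t * ev k $ l)"
      using exp_converges[of "of_real t * ev k $ l"]
      by (simp add: scaleR_conv_of_real power_mult_distrib field_simps)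
    then show ?thesis
      unfolding sums_def c_def by (rule LIM_zero)
  qed
  obtain K where K: "\<And>k. k \<ge> K \<Longrightarrow> fock_coeff k (fock_embed u) = 0"
    using fock_embed_finite_support by metis
  \<comment> \<open>The total scalar error over the finitely many degrees below K and all l; it
    bounds each single error and tends to 0 as a finite sum of null sequences.\<close>
  define B where "B N = (\<Sum>k<K. \<Sum>l\<in>UNIV. cmod (c N k l))" for N
  have B0: "0 \<le> B N * P_bound" for N
    by (simp add: B_def sum_nonneg P_bound_nonneg)
  have le: "coeff_norm \<alpha> k (fock_coeff k (?S N - flow t (fock_embed u)))
      \<le> B N * P_bound * coeff_norm \<alpha> k (fock_coeff k (fock_embed u))" for N k
  proof (cases "k < K")
    case True
    have "cmod (c N k l) \<le> B N" for l
    proof -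
      have "cmod (c N k l) \<le> (\<Sum>l\<in>UNIV. cmod (c N k l))" by (rule member_le_sum) auto
      also have "\<dots> \<le> B N"
        unfolding B_def using True by (intro member_le_sum[of k "{..<K}" "\<lambda>k. \<Sum>l\<in>UNIV. cmod (c N k l)"])
          (auto intro: sum_nonneg)
      finally show ?thesis .
    qed
    then show ?thesis unfolding coeff by (rule coeff_norm_calc_le)
  next
    case False
    then show ?thesis unfolding coeff by (simp add: K)
  qed
  have "(\<lambda>N. B N * P_bound * fock_norm \<alpha> (fock_embed u)) \<longlonglongrightarrow> 0 * P_bound * fock_norm \<alpha> (fock_embed u)"
    unfolding B_def
    by (intro tendsto_mult tendsto_const tendsto_null_sum tendsto_norm_zero c_lim)
  then have *: "(\<lambda>N. B N * P_bound * fock_norm \<alpha> (fock_embed u)) \<longlonglongrightarrow> 0"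
    by simp
  show ?thesis
  proof (rule tendsto_sandwich[OF _ _ tendsto_const *])
    show "\<forall>\<^sub>F N in sequentially. 0 \<le> fock_norm \<alpha> (?S N - flow t (fock_embed u))"
      by (intro always_eventually allI fock_norm_nonneg
          fock_space_dominated(1)[OF fock_embed_in_fock_space B0 le])
    show "\<forall>\<^sub>F N in sequentially. fock_norm \<alpha> (?S N - flow t (fock_embed u))
        \<le> B N * P_bound * fock_norm \<alpha> (fock_embed u)"
      by (intro always_eventually allI fock_space_dominated(2)[OF fock_embed_in_fock_space B0 le])
  qed
qed

lemma fock_exp_group_flow:
  assumes "\<And>k u. fock_coeff k (fock_embed (D u)) = calc (\<lambda>l. ev k $ l) (fock_coeff k (fock_embed u))"
  shows "fock_exp_group \<alpha> D flow"
  unfolding fock_exp_group_def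
  \<comment> \<open>The radius 1 is arbitrary, since here the exponential series converges for every
    t.\<close>
  by (intro conjI allI ballI exI[of _ 1] impI fock_bounded_op_flow flow_0 flow_add flow_continuous
      flow_exp_series[OF assms]) simp_all

text \<open>The interface for the five subgroups: it remains only to diagonalize the generator on
  polynomials. The group parameter is absorbed into the generator, so the flow is taken at time
  1.\<close>

lemma fock_coeff_fock_exp:
  assumes "\<alpha> \<notin> \<nat>" "f \<in> fock_space \<alpha>"
    and "\<And>k u. fock_coeff k (fock_embed (D u)) = calc (\<lambda>l. ev k $ l) (fock_coeff k (fock_embed u))"
  shows "fock_coeff k (fock_exp \<alpha> D f) = calc (\<lambda>l. exp (ev k $ l)) (fock_coeff k f)"
  by (simp add: fock_exp_eq[OF assms(1) fock_exp_group_flow assms(2)] assms(3) fock_coeff_flow)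

end

section \<open>The action on homogeneous components\<close>

lemma fock_of_poly_eq_class: "fock_of_poly g = fock_class (SP [:g $ 1, g $ 2:] [:g $ 3:] [:g $ 4:] 0)"
proof -
  have "in_z1 (g $ 1) + in_z1 (g $ 2) * z2 + in_z1 (g $ 3) * z3 + in_z1 (g $ 4) * z4
      = SP [:g $ 1, g $ 2:] [:g $ 3:] [:g $ 4:] 0"
    by (rule superpoly.expand) (simp add: in_z1_def z2_def z3_def z4_def)
  then show ?thesis by (simp add: fock_of_poly_def)
qed

text \<open>Modulo the ideal z3 z4 equals -2 z1 z2, so the z3 z4 coefficient moves into the z2
  coefficient with factor -2 z1. The remaining terms contain z2^2, z2 z3 or z2 z4 and
  vanish.\<close>

lemma fock_class_normal_form:
  "fock_class p = fock_of_poly (vector [coeff (sp0 p) 0,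
     coeff (sp0 p) (Suc 0) - [:0, 2:] * coeff (sp34 p) 0, coeff (sp3 p) 0, coeff (sp4 p) 0])"
  by (simp add: fock_of_poly_eq_class fock_class_eq_iff fock_ideal_iff)

lemma drho_fock_class: "drho \<alpha> X (fock_class p) = fock_class (drho_poly \<alpha> X p)"
  by transfer (simp add: fock_rel_def fock_ideal.zero)

lemma fock_coeff_embed_class:
  "fock_coeff k (fock_embed (fock_class p)) = vector [coeff (coeff (sp0 p) 0) k,
     coeff (coeff (sp0 p) (Suc 0) - [:0, 2:] * coeff (sp34 p) 0) k,
     coeff (coeff (sp3 p) 0) k, coeff (coeff (sp4 p) 0) k]"
  by (simp add: fock_class_normal_form fock_embed_of_poly fock_coeff_def vec_eq_iff forall_4)

lemma fock_poly_cases: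
  obtains a b c d where "u = fock_class (SP [:a, b:] [:c:] [:d:] 0)"
  by (metis bij_fock_of_poly bij_is_surj surjD fock_of_poly_eq_class)

section \<open>Values of the generators on polynomials\<close>

lemma sconst_0 [simp]: "sconst 0 = 0"
  by (simp add: sconst_def zero_superpoly_def)

lemma sconst_hom:
  "sconst (a + b) = sconst a + sconst b" "sconst (- a) = - sconst a"
  "sconst (a * b) = sconst a * sconst b"
  by (simp_all add: sconst_def plus_superpoly_def uminus_superpoly_def times_superpoly_def)

lemma sl_comb_0 [simp]: "sl_comb 0 e f h p = 0"
  by (simp add: sl_comb_def)

lemma sl_comb_rotation:
  "sl_comb (t *\<^sub>R (slF - slE)) e f h p = sconst (of_real t) * f p - sconst (of_real t) * e p"
  by (simp add: sl_comb_def slE_def slF_def sconst_hom)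

text \<open>The terms in z1 + B(z1) cancel in F_2 - E_2, while the two halves of \<open>L1\<close>
  add up to -i \<open>L1\<close>.\<close>

lemma sl_comb_rotation_L1:
  "sl_comb (t *\<^sub>R (slF - slE)) (drho_E2 \<alpha>) (drho_F2 \<alpha>) h p = sconst (- \<i> * t) * L1 \<alpha> p"
proof -
  \<comment> \<open>Splitting i t into two halves matches the factors i/2 with which
    \<open>L1\<close> enters the images of E_2 and F_2.\<close>
  have "sconst (\<i> * t) = sconst (t * (\<i>/2) + t * (\<i>/2))" by simp
  then have "sconst (\<i> * t) = sconst t * sconst (\<i>/2) + sconst t * sconst (\<i>/2)"
    unfolding sconst_hom .
  then show ?thesis
    by (simp only: sl_comb_rotation drho_F2_def drho_E2_def sconst_hom(2) mult_minus_left)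
      (simp add: algebra_simps)
qed

text \<open>The same cancellation in F_3 - E_3, now of the terms in z2 + B(z2).\<close>

lemma sl_comb_rotation_L2:
  "sl_comb (t *\<^sub>R (slF - slE)) (drho_E3) (drho_F3) h p = sconst (- \<i> * t) * L2 p"
proof -
  have "sconst (\<i> * t) = sconst (t * (\<i>/2) + t * (\<i>/2))" by simp
  then have "sconst (\<i> * t) = sconst t * sconst (\<i>/2) + sconst t * sconst (\<i>/2)"
    unfolding sconst_hom .
  then show ?thesis
    by (simp only: sl_comb_rotation drho_F3_def drho_E3_def sconst_hom(2) mult_minus_left)
      (simp add: algebra_simps)
qed

lemma sl_comb_slH: "sl_comb (t *\<^sub>R slH) e f h p = sconst (of_real t) * h p"
  by (simp add: sl_comb_def slH_def)

lemma fock_coeff_drho_K1: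
  fixes u :: fockpoly and t :: real
  defines "v k \<equiv> fock_coeff k (fock_embed u)"
  shows "fock_coeff k (fock_embed (drho \<alpha> (t *\<^sub>R (slF - slE), 0, 0) u))
     = vector [0, 0, 2 * t * v k $ 4, - t / 2 * v k $ 3]"
proof (cases u rule: fock_poly_cases)
  case (1 a b c d)
  then show ?thesis
    by (simp add: v_def drho_fock_class drho_poly_def sl_comb_rotation fock_coeff_embed_class
        drho_E1_def drho_F1_def d3_def d4_def z3_def z4_def sconst_def two_superpoly coeff_mult_0
        coeff_two_poly numeral_poly vec_eq_iff forall_4)
qed

text \<open>\<open>L1\<close> has eigenvalue 2k - \<alpha> on z1^k and z1^k z2, and 2k - \<alpha> +
  1 on z1^k z3 and z1^k z4; the factor -i t gives the stated values.\<close>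

lemma fock_coeff_drho_K2:
  fixes u :: fockpoly and t :: real
  defines "v k \<equiv> fock_coeff k (fock_embed u)"
  shows "fock_coeff k (fock_embed (drho \<alpha> (0, t *\<^sub>R (slF - slE), 0) u))
     = vector [\<i> * t * (\<alpha> - 2 * of_nat k) * v k $ 1, \<i> * t * (\<alpha> - 2 * of_nat k) * v k $ 2,
         \<i> * t * (\<alpha> - 1 - 2 * of_nat k) * v k $ 3, \<i> * t * (\<alpha> - 1 - 2 * of_nat k) * v k $ 4]"
proof (cases u rule: fock_poly_cases)
  case (1 a b c d)
  show ?thesis
    unfolding v_def 1 drho_fock_class drho_poly_def prod.case sl_comb_rotation_L1
    by (simp add: fock_coeff_embed_class
        L1_def d1_def d3_def d4_def z1_def z3_def z4_def sconst_def two_superpoly coeff_mult_0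
        coeff_1_mult coeff_two_poly coeff_map_poly coeff_pderiv coeff_pCons vec_eq_iff forall_4
        numeral_poly algebra_simps split: nat.split)
qed

text \<open>\<open>L2\<close> has eigenvalues -1, 1, 0, 0 on the four basis vectors of each
  component, again multiplied by -i t.\<close>

lemma fock_coeff_drho_K3:
  fixes u :: fockpoly and t :: real
  defines "v k \<equiv> fock_coeff k (fock_embed u)"
  shows "fock_coeff k (fock_embed (drho \<alpha> (0, 0, t *\<^sub>R (slF - slE)) u))
     = vector [\<i> * t * v k $ 1, - \<i> * t * v k $ 2, 0, 0]"
proof (cases u rule: fock_poly_cases)
  case (1 a b c d)
  show ?thesis
    unfolding v_def 1 drho_fock_class drho_poly_def prod.case sl_comb_rotation_L2
    by (simp add: fock_coeff_embed_class
        L2_def d2_def d3_def d4_def z2_def z3_def z4_def sconst_def two_superpoly coeff_mult_0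
        coeff_1_mult coeff_two_poly coeff_pderiv coeff_pCons vec_eq_iff forall_4
        numeral_poly algebra_simps split: nat.split)
qed

lemma fock_coeff_drho_A1:
  fixes u :: fockpoly and t :: real
  defines "v k \<equiv> fock_coeff k (fock_embed u)"
  shows "fock_coeff k (fock_embed (drho \<alpha> (t *\<^sub>R slH, 0, 0) u))
     = vector [0, 0, - t * v k $ 3, t * v k $ 4]"
proof (cases u rule: fock_poly_cases)
  case (1 a b c d)
  then show ?thesis
    by (simp add: v_def drho_fock_class drho_poly_def sl_comb_slH fock_coeff_embed_class
        drho_H1_def d3_def d4_def z3_def z4_def sconst_def coeff_mult_0 vec_eq_iff forall_4)
qed

text \<open>Multiplication by z2 takes z1^k to z1^k z2 and kills the other three basis vectors
  modulo the ideal; -B(z2) takes z1^k z2 back to z1^k and kills the rest.\<close>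

lemma fock_coeff_drho_A3:
  fixes u :: fockpoly and t :: real
  defines "v k \<equiv> fock_coeff k (fock_embed u)"
  shows "fock_coeff k (fock_embed (drho \<alpha> (0, 0, t *\<^sub>R slH) u))
     = vector [t * v k $ 2, t * v k $ 1, 0, 0]"
proof (cases u rule: fock_poly_cases)
  case (1 a b c d)
  then show ?thesis
    by (simp add: v_def drho_fock_class drho_poly_def sl_comb_slH fock_coeff_embed_class
        drho_H3_def Bz2_def Let_def d2_def d3_def d4_def z1_def z2_def z3_def z4_def sconst_def
        two_superpoly coeff_mult_0 coeff_1_mult coeff_two_poly coeff_pderiv vec_eq_iff forall_4)
qed

section \<open>Exponentials of two-by-two matrices\<close>

lemma mat_exp_eqI:
  assumes "\<And>i j. (\<lambda>n. ((\<lambda>Y. X ** Y) ^^ n) (mat 1) $ i $ j / fact n) sums E $ i $ j"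
  shows "mat_exp X = E"
proof -
  have "(\<lambda>n. (1 / fact n) *\<^sub>R ((\<lambda>Y. X ** Y) ^^ n) (mat 1)) sums E"
    unfolding sums_def
    by (intro vec_tendstoI) (use assms in \<open>simp add: sums_def\<close>)
  then show ?thesis
    unfolding mat_exp_def by (rule sums_unique[symmetric])
qed

text \<open>The matrix F - E is multiplication by i on the complex plane, so the powers are those of
  i t and the entries of the exponential are the real and imaginary parts of exp (i t).\<close>

lemma mat_exp_rotation: "mat_exp (t *\<^sub>R (slF - slE)) = rotK t"
proof (rule mat_exp_eqI)
  let ?X = "t *\<^sub>R (slF - slE)" and ?z = "\<lambda>n. (\<i> * of_real t) ^ n"
  have pow: "((\<lambda>Y. ?X ** Y) ^^ n) (mat 1) =
      vector [vector [Re (?z n), - Im (?z n)], vector [Im (?z n), Re (?z n)]]" for n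
    by (induction n)
      (simp_all add: vec_eq_iff forall_2 matrix_matrix_mult_def sum_2 mat_def slE_def slF_def)
  have "(\<lambda>n. ?z n /\<^sub>R fact n) sums exp (\<i> * of_real t)"
    by (rule exp_converges)
  then have "(\<lambda>n. Re (?z n) / fact n) sums cos t" "(\<lambda>n. Im (?z n) / fact n) sums sin t"
    by (auto dest: sums_Re sums_Im simp: exp_Euler divide_inverse mult.commute cos_of_real sin_of_real)
  moreover from this(2) have "(\<lambda>n. - Im (?z n) / fact n) sums - sin t"
    using sums_minus by fastforce
  ultimately have "\<forall>i j. (\<lambda>n. ((\<lambda>Y. ?X ** Y) ^^ n) (mat 1) $ i $ j / fact n) sums rotK t $ i $ j"
    by (simp add: forall_2 pow rotK_def)
  then show "(\<lambda>n. ((\<lambda>Y. ?X ** Y) ^^ n) (mat 1) $ i $ j / fact n) sums rotK t $ i $ j" for i j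
    by blast
qed

lemma mat_exp_slH: "mat_exp (t *\<^sub>R slH) = diagA t"
proof (rule mat_exp_eqI)
  let ?X = "t *\<^sub>R slH"
  have pow: "((\<lambda>Y. ?X ** Y) ^^ n) (mat 1) = vector [vector [t ^ n, 0], vector [0, (- t) ^ n]]" for n
    by (induction n)
      (simp_all add: vec_eq_iff forall_2 matrix_matrix_mult_def sum_2 mat_def slH_def)
  have "(\<lambda>n. s ^ n / fact n) sums exp s" for s :: real
    using exp_converges[of s] by (simp add: divide_inverse mult.commute)
  then have "\<forall>i j. (\<lambda>n. ((\<lambda>Y. ?X ** Y) ^^ n) (mat 1) $ i $ j / fact n) sums diagA t $ i $ j"
    by (simp add: forall_2 pow diagA_def)
  then show "(\<lambda>n. ((\<lambda>Y. ?X ** Y) ^^ n) (mat 1) $ i $ j / fact n) sums diagA t $ i $ j" for i j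
    by blast
qed

lemma mat_exp_0: "mat_exp 0 = mat 1"
  using mat_exp_slH[of 0] by (simp add: diagA_def mat_def vec_eq_iff forall_2)

section \<open>The five one-parameter subgroups\<close>

lemma fock_coeff_op_matrix_apply:
  "fock_coeff k (M \<odot> f) = (\<chi> i. \<Sum>j\<in>UNIV. fps_nth ((M $ i $ j) (f $ j)) k)"
  by (simp add: fock_coeff_def op_matrix_apply_def fps_sum_nth)

lemma fock_coeff_nth: "fock_coeff k f $ i = fps_nth (f $ i) k"
  by (simp add: fock_coeff_def)

lemma fps_nth_scal [simp]: "fps_nth (scal c g) n = c * fps_nth g n"
  by (simp add: scal_def)

lemma fps_nth_euler: "fps_nth (euler g) n = of_nat n * fps_nth g n"
  by (cases n) (simp_all add: euler_def)

text \<open>The Euler operator multiplies the n-th coefficient by n, so the operator is diagonal on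
  coefficients and its exponential series reduces to a scalar one.\<close>

lemma fps_nth_op_exp_euler:
  "fps_nth (fps_op_exp (\<lambda>g. scal c (scal a g - scal 2 (euler g))) g) n
     = exp (c * (a - 2 * of_nat n)) * fps_nth g n"
proof -
  let ?T = "\<lambda>g. scal c (scal a g - scal 2 (euler g))"
  have "fps_nth ((?T ^^ j) g) n = (c * (a - 2 * of_nat n)) ^ j * fps_nth g n" for j
    by (induction j) (simp_all add: fps_nth_euler algebra_simps)
  moreover have "(\<lambda>j. (c * (a - 2 * of_nat n)) ^ j / fact j * fps_nth g n) sums
      (exp (c * (a - 2 * of_nat n)) * fps_nth g n)"
    using exp_converges[of "c * (a - 2 * of_nat n)"]
    by (intro sums_mult2) (simp add: scaleR_conv_of_real divide_inverse mult.commute)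
  ultimately show ?thesis
    by (simp add: fps_op_exp_def sums_unique[symmetric])
qed

lemma rho0_K1:
  assumes "\<alpha> \<notin> \<nat>" "f \<in> fock_space \<alpha>"
  shows "rho0 \<alpha> (t *\<^sub>R (slF - slE), 0, 0) f =
     vector [vector [scal 1, scal 0, scal 0, scal 0],
             vector [scal 0, scal 1, scal 0, scal 0],
             vector [scal 0, scal 0, scal (cos t), scal (2 * sin t)],
             vector [scal 0, scal 0, scal (- sin t / 2), scal (cos t)]] \<odot> f"
proof -
  \<comment> \<open>On the coordinates 3, 4 the generator is t N, where N has off-diagonal entries 2
    and -1/2. Since N^2 = -1, the projections for the eigenvalues i t and -i t are (1 - i N)/2 and
    (1 + i N)/2.\<close>
  define P :: "(complex^4^4)^3" where "P = vector
    [vector [vector [1, 0, 0, 0], vector [0, 1, 0, 0], 0, 0],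
     vector [0, 0, vector [0, 0, 1/2, - \<i>], vector [0, 0, \<i>/4, 1/2]],
     vector [0, 0, vector [0, 0, 1/2, \<i>], vector [0, 0, - \<i>/4, 1/2]]]"
  define ev :: "nat \<Rightarrow> complex^3" where "ev k = vector [0, \<i> * t, - \<i> * t]" for k
  have "\<forall>l m. P $ l ** P $ m = (if l = m then P $ l else 0)"
    by (simp add: forall_3 P_def matrix_matrix_mult_def vec_eq_iff forall_4 sum_4)
  moreover have "(\<Sum>l\<in>UNIV. P $ l) = mat 1"
    by (simp add: sum_3 P_def mat_def vec_eq_iff forall_4)
  moreover have "\<forall>l i j. P $ l $ i $ j \<noteq> 0 \<longrightarrow> (i = 1 \<or> i = 2) = (j = 1 \<or> j = 2)"
    by (simp add: forall_3 forall_4 P_def)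
  moreover have "\<forall>k l. \<bar>Re (ev k $ l)\<bar> \<le> 0"
    by (simp add: forall_3 ev_def)
  ultimately interpret fock_spectral P ev 0
    by unfold_locales blast+
  have calc: "calc c v = vector [c 1 * v $ 1, c 1 * v $ 2,
      (c 2 + c 3) / 2 * v $ 3 - \<i> * (c 2 - c 3) * v $ 4,
      \<i> * (c 2 - c 3) / 4 * v $ 3 + (c 2 + c 3) / 2 * v $ 4]" for c v
    unfolding calc_def sum_3
    by (simp add: P_def matrix_vector_mult_def vec_eq_iff forall_4 sum_4 field_simps)
  have "fock_coeff k (fock_embed (drho \<alpha> (t *\<^sub>R (slF - slE), 0, 0) u))
      = calc (\<lambda>l. ev k $ l) (fock_coeff k (fock_embed u))" for k u
    unfolding fock_coeff_drho_K1
    by (simp add: calc ev_def vec_eq_iff forall_4 algebra_simps)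
  note coeff_exp = fock_coeff_fock_exp[OF assms this]
  show ?thesis
    unfolding rho0_def
    by (intro fock_eqI, unfold coeff_exp)
      (simp add: fock_coeff_op_matrix_apply calc ev_def vec_eq_iff forall_4 sum_4 fock_coeff_nth
        cos_exp_eq sin_exp_eq cos_of_real[symmetric] sin_of_real[symmetric] field_simps)
qed

lemma rho0_K2:
  assumes "\<alpha> \<notin> \<nat>" "f \<in> fock_space \<alpha>"
  shows "rho0 \<alpha> (0, t *\<^sub>R (slF - slE), 0) f =
       (let e = fps_op_exp (\<lambda>g. scal (\<i> * t) (scal \<alpha> g - scal 2 (euler g)));
            e' = fps_op_exp (\<lambda>g. scal (\<i> * t) (scal (\<alpha> - 1) g - scal 2 (euler g)))
        in vector [vector [e, scal 0, scal 0, scal 0],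
                   vector [scal 0, e, scal 0, scal 0],
                   vector [scal 0, scal 0, e', scal 0],
                   vector [scal 0, scal 0, scal 0, e']] \<odot> f)"
proof -
  \<comment> \<open>The generator is scalar on each block, so the two block projections suffice;
    only the eigenvalues depend on k.\<close>
  define P :: "(complex^4^4)^2" where "P = vector
    [vector [vector [1, 0, 0, 0], vector [0, 1, 0, 0], 0, 0],
     vector [0, 0, vector [0, 0, 1, 0], vector [0, 0, 0, 1]]]"
  define ev :: "nat \<Rightarrow> complex^2" where
    "ev k = vector [\<i> * t * (\<alpha> - 2 * of_nat k), \<i> * t * (\<alpha> - 1 - 2 * of_nat k)]" for k
  have "\<forall>l m. P $ l ** P $ m = (if l = m then P $ l else 0)"
    by (simp add: forall_2 P_def matrix_matrix_mult_def vec_eq_iff forall_4 sum_4)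
  moreover have "(\<Sum>l\<in>UNIV. P $ l) = mat 1"
    by (simp add: sum_2 P_def mat_def vec_eq_iff forall_4)
  moreover have "\<forall>l i j. P $ l $ i $ j \<noteq> 0 \<longrightarrow> (i = 1 \<or> i = 2) = (j = 1 \<or> j = 2)"
    by (simp add: forall_2 forall_4 P_def)
  moreover have "\<forall>k l. \<bar>Re (ev k $ l)\<bar> \<le> 0"
    by (simp add: forall_2 ev_def)
  ultimately interpret fock_spectral P ev 0
    by unfold_locales blast+
  have calc: "calc c v = vector [c 1 * v $ 1, c 1 * v $ 2, c 2 * v $ 3, c 2 * v $ 4]" for c v
    unfolding calc_def sum_2
    by (simp add: P_def matrix_vector_mult_def vec_eq_iff forall_4 sum_4 field_simps)
  have "fock_coeff k (fock_embed (drho \<alpha> (0, t *\<^sub>R (slF - slE), 0) u))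
      = calc (\<lambda>l. ev k $ l) (fock_coeff k (fock_embed u))" for k u
    unfolding fock_coeff_drho_K2
    by (simp add: calc ev_def vec_eq_iff forall_4)
  note coeff_exp = fock_coeff_fock_exp[OF assms this]
  show ?thesis
    unfolding rho0_def
    by (intro fock_eqI, unfold coeff_exp)
      (simp add: fock_coeff_op_matrix_apply calc ev_def vec_eq_iff forall_4 sum_4 fock_coeff_nth Let_def fps_nth_op_exp_euler)
qed

lemma rho0_K3:
  assumes "\<alpha> \<notin> \<nat>" "f \<in> fock_space \<alpha>"
  shows "rho0 \<alpha> (0, 0, t *\<^sub>R (slF - slE)) f =
     vector [vector [scal (exp (\<i> * t)), scal 0, scal 0, scal 0],
             vector [scal 0, scal (exp (- \<i> * t)), scal 0, scal 0],
             vector [scal 0, scal 0, scal 1, scal 0],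
             vector [scal 0, scal 0, scal 0, scal 1]] \<odot> f"
proof -
  define P :: "(complex^4^4)^3" where "P = vector
    [vector [0, 0, vector [0, 0, 1, 0], vector [0, 0, 0, 1]],
     vector [vector [1, 0, 0, 0], 0, 0, 0], vector [0, vector [0, 1, 0, 0], 0, 0]]"
  define ev :: "nat \<Rightarrow> complex^3" where "ev k = vector [0, \<i> * t, - \<i> * t]" for k
  have "\<forall>l m. P $ l ** P $ m = (if l = m then P $ l else 0)"
    by (simp add: forall_3 P_def matrix_matrix_mult_def vec_eq_iff forall_4 sum_4)
  moreover have "(\<Sum>l\<in>UNIV. P $ l) = mat 1"
    by (simp add: sum_3 P_def mat_def vec_eq_iff forall_4)
  moreover have "\<forall>l i j. P $ l $ i $ j \<noteq> 0 \<longrightarrow> (i = 1 \<or> i = 2) = (j = 1 \<or> j = 2)"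
    by (simp add: forall_3 forall_4 P_def)
  moreover have "\<forall>k l. \<bar>Re (ev k $ l)\<bar> \<le> 0"
    by (simp add: forall_3 ev_def)
  ultimately interpret fock_spectral P ev 0
    by unfold_locales blast+
  have calc: "calc c v = vector [c 2 * v $ 1, c 3 * v $ 2, c 1 * v $ 3, c 1 * v $ 4]" for c v
    unfolding calc_def sum_3
    by (simp add: P_def matrix_vector_mult_def vec_eq_iff forall_4 sum_4 field_simps)
  have "fock_coeff k (fock_embed (drho \<alpha> (0, 0, t *\<^sub>R (slF - slE)) u))
      = calc (\<lambda>l. ev k $ l) (fock_coeff k (fock_embed u))" for k u
    unfolding fock_coeff_drho_K3
    by (simp add: calc ev_def vec_eq_iff forall_4)
  note coeff_exp = fock_coeff_fock_exp[OF assms this]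
  show ?thesis
    unfolding rho0_def
    by (intro fock_eqI, unfold coeff_exp)
      (simp add: fock_coeff_op_matrix_apply calc ev_def vec_eq_iff forall_4 sum_4 fock_coeff_nth)
qed

lemma rho0_A1:
  assumes "\<alpha> \<notin> \<nat>" "f \<in> fock_space \<alpha>"
  shows "rho0 \<alpha> (t *\<^sub>R slH, 0, 0) f =
     vector [vector [scal 1, scal 0, scal 0, scal 0],
             vector [scal 0, scal 1, scal 0, scal 0],
             vector [scal 0, scal 0, scal (exp (- t)), scal 0],
             vector [scal 0, scal 0, scal 0, scal (exp t)]] \<odot> f"
proof -
  \<comment> \<open>The second projection is onto the z4 coordinate (eigenvalue t), the third onto
    the z3 coordinate (eigenvalue -t). These eigenvalues are real, hence the bound |t| instead of
    0.\<close>
  define P :: "(complex^4^4)^3" where "P = vector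
    [vector [vector [1, 0, 0, 0], vector [0, 1, 0, 0], 0, 0],
     vector [0, 0, 0, vector [0, 0, 0, 1]], vector [0, 0, vector [0, 0, 1, 0], 0]]"
  define ev :: "nat \<Rightarrow> complex^3" where "ev k = vector [0, t, - t]" for k
  have "\<forall>l m. P $ l ** P $ m = (if l = m then P $ l else 0)"
    by (simp add: forall_3 P_def matrix_matrix_mult_def vec_eq_iff forall_4 sum_4)
  moreover have "(\<Sum>l\<in>UNIV. P $ l) = mat 1"
    by (simp add: sum_3 P_def mat_def vec_eq_iff forall_4)
  moreover have "\<forall>l i j. P $ l $ i $ j \<noteq> 0 \<longrightarrow> (i = 1 \<or> i = 2) = (j = 1 \<or> j = 2)"
    by (simp add: forall_3 forall_4 P_def)
  moreover have "\<forall>k l. \<bar>Re (ev k $ l)\<bar> \<le> \<bar>t\<bar>"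
    by (simp add: forall_3 ev_def)
  ultimately interpret fock_spectral P ev "\<bar>t\<bar>"
    by unfold_locales blast+
  have calc: "calc c v = vector [c 1 * v $ 1, c 1 * v $ 2, c 3 * v $ 3, c 2 * v $ 4]" for c v
    unfolding calc_def sum_3
    by (simp add: P_def matrix_vector_mult_def vec_eq_iff forall_4 sum_4 field_simps)
  have "fock_coeff k (fock_embed (drho \<alpha> (t *\<^sub>R slH, 0, 0) u))
      = calc (\<lambda>l. ev k $ l) (fock_coeff k (fock_embed u))" for k u
    unfolding fock_coeff_drho_A1
    by (simp add: calc ev_def vec_eq_iff forall_4)
  note coeff_exp = fock_coeff_fock_exp[OF assms this]
  show ?thesis
    unfolding rho0_def
    by (intro fock_eqI, unfold coeff_exp)
      (simp add: fock_coeff_op_matrix_apply calc ev_def vec_eq_iff forall_4 sum_4 fock_coeff_nth exp_of_real[symmetric])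
qed

lemma rho0_A3:
  assumes "\<alpha> \<notin> \<nat>" "f \<in> fock_space \<alpha>"
  shows "rho0 \<alpha> (0, 0, t *\<^sub>R slH) f =
     vector [vector [scal (cosh t), scal (sinh t), scal 0, scal 0],
             vector [scal (sinh t), scal (cosh t), scal 0, scal 0],
             vector [scal 0, scal 0, scal 1, scal 0],
             vector [scal 0, scal 0, scal 0, scal 1]] \<odot> f"
proof -
  \<comment> \<open>On the coordinates 1, 2 the generator is t times the swap S. The projections (1
    + S)/2 and (1 - S)/2 belong to t and -t, and the exponentials recombine to cosh and
    sinh.\<close>
  define P :: "(complex^4^4)^3" where "P = vector
    [vector [0, 0, vector [0, 0, 1, 0], vector [0, 0, 0, 1]],
     vector [vector [1/2, 1/2, 0, 0], vector [1/2, 1/2, 0, 0], 0, 0],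
     vector [vector [1/2, -1/2, 0, 0], vector [-1/2, 1/2, 0, 0], 0, 0]]"
  define ev :: "nat \<Rightarrow> complex^3" where "ev k = vector [0, t, - t]" for k
  have "\<forall>l m. P $ l ** P $ m = (if l = m then P $ l else 0)"
    by (simp add: forall_3 P_def matrix_matrix_mult_def vec_eq_iff forall_4 sum_4)
  moreover have "(\<Sum>l\<in>UNIV. P $ l) = mat 1"
    by (simp add: sum_3 P_def mat_def vec_eq_iff forall_4)
  moreover have "\<forall>l i j. P $ l $ i $ j \<noteq> 0 \<longrightarrow> (i = 1 \<or> i = 2) = (j = 1 \<or> j = 2)"
    by (simp add: forall_3 forall_4 P_def)
  moreover have "\<forall>k l. \<bar>Re (ev k $ l)\<bar> \<le> \<bar>t\<bar>"
    by (simp add: forall_3 ev_def)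
  ultimately interpret fock_spectral P ev "\<bar>t\<bar>"
    by unfold_locales blast+
  have calc: "calc c v = vector [(c 2 + c 3) / 2 * v $ 1 + (c 2 - c 3) / 2 * v $ 2,
      (c 2 - c 3) / 2 * v $ 1 + (c 2 + c 3) / 2 * v $ 2, c 1 * v $ 3, c 1 * v $ 4]" for c v
    unfolding calc_def sum_3
    by (simp add: P_def matrix_vector_mult_def vec_eq_iff forall_4 sum_4 field_simps)
  have "fock_coeff k (fock_embed (drho \<alpha> (0, 0, t *\<^sub>R slH) u))
      = calc (\<lambda>l. ev k $ l) (fock_coeff k (fock_embed u))" for k u
    unfolding fock_coeff_drho_A3
    by (simp add: calc ev_def vec_eq_iff forall_4 algebra_simps)
  note coeff_exp = fock_coeff_fock_exp[OF assms this]
  show ?thesis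
    unfolding rho0_def
    by (intro fock_eqI, unfold coeff_exp)
      (simp add: fock_coeff_op_matrix_apply calc ev_def vec_eq_iff forall_4 sum_4 fock_coeff_nth
        cosh_def sinh_def scaleR_conv_of_real exp_of_real[symmetric] field_simps)
qed

text \<open>Because \<open>rho0\<close> is indexed by Lie algebra elements, each operator formula is
  paired with the matrix exponential that identifies the group element concerned.\<close>

theorem corollary5p2:
  fixes \<alpha> k1 k2 k3 a1 a3 :: real and f :: fock
  assumes "\<alpha> \<notin> \<nat>" and "f \<in> fock_space \<alpha>"
  shows
    "(group_exp (k1 *\<^sub>R (slF - slE), 0, 0) = (rotK k1, mat 1, mat 1) \<and>
     rho0 \<alpha> (k1 *\<^sub>R (slF - slE), 0, 0) f =
       vector [vector [scal 1, scal 0, scal 0, scal 0],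
               vector [scal 0, scal 1, scal 0, scal 0],
               vector [scal 0, scal 0, scal (cos k1), scal (2 * sin k1)],
               vector [scal 0, scal 0, scal (- sin k1 / 2), scal (cos k1)]] \<odot> f) \<and>
     (group_exp (0, k2 *\<^sub>R (slF - slE), 0) = (mat 1, rotK k2, mat 1) \<and>
     rho0 \<alpha> (0, k2 *\<^sub>R (slF - slE), 0) f =
       (let e = fps_op_exp (\<lambda>g. scal (\<i> * k2) (scal \<alpha> g - scal 2 (euler g)));
            e' = fps_op_exp (\<lambda>g. scal (\<i> * k2) (scal (\<alpha> - 1) g - scal 2 (euler g)))
        in vector [vector [e, scal 0, scal 0, scal 0],
                   vector [scal 0, e, scal 0, scal 0],
                   vector [scal 0, scal 0, e', scal 0],
                   vector [scal 0, scal 0, scal 0, e']] \<odot> f)) \<and>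
     (group_exp (0, 0, k3 *\<^sub>R (slF - slE)) = (mat 1, mat 1, rotK k3) \<and>
     rho0 \<alpha> (0, 0, k3 *\<^sub>R (slF - slE)) f =
       vector [vector [scal (exp (\<i> * k3)), scal 0, scal 0, scal 0],
               vector [scal 0, scal (exp (- \<i> * k3)), scal 0, scal 0],
               vector [scal 0, scal 0, scal 1, scal 0],
               vector [scal 0, scal 0, scal 0, scal 1]] \<odot> f) \<and>
     (group_exp (a1 *\<^sub>R slH, 0, 0) = (diagA a1, mat 1, mat 1) \<and>
     rho0 \<alpha> (a1 *\<^sub>R slH, 0, 0) f =
       vector [vector [scal 1, scal 0, scal 0, scal 0],
               vector [scal 0, scal 1, scal 0, scal 0],
               vector [scal 0, scal 0, scal (exp (- a1)), scal 0],
               vector [scal 0, scal 0, scal 0, scal (exp a1)]] \<odot> f) \<and>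
     (group_exp (0, 0, a3 *\<^sub>R slH) = (mat 1, mat 1, diagA a3) \<and>
     rho0 \<alpha> (0, 0, a3 *\<^sub>R slH) f =
       vector [vector [scal (cosh a3), scal (sinh a3), scal 0, scal 0],
               vector [scal (sinh a3), scal (cosh a3), scal 0, scal 0],
               vector [scal 0, scal 0, scal 1, scal 0],
               vector [scal 0, scal 0, scal 0, scal 1]] \<odot> f)"
  using assms by (simp only: rho0_K1 rho0_K2 rho0_K3 rho0_A1 rho0_A3 group_exp_def prod.case
      mat_exp_rotation mat_exp_slH mat_exp_0 simp_thms)

end
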